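(* In the Fourier regression with $n=3$, the three-point tube-volume optimal designs are precisely the designs with points $t_i$ and weights $p_i$, $i=1,2,3$, given by $$t_i=\frac1\pi\tan^{-1}\bigl(q\tan(\pi(t_i^0-\theta))+r\bigr),\qquad p_i=k\left(\frac{1+\bigl(q\tan(\pi(t_i^0-\theta))+r\bigr)^2}{1+\tan^2(\pi(t_i^0-\theta))}\right)^2,$$ where $(t^0_1,t^0_2,t^0_3)=(-\frac13,0,\frac13)$, $k$ is the normalizing constant such that $\sum_ip_i=1$, and $q\neq0$, $r$, $\theta$ are arbitrary real numbers. In particular, the uniform design (a D-optimal design) with points $t_i^0-\theta$ and weights $\frac13$, $i=1,2,3$, is a tube-volume optimal design.
   Context: The Fourier regression with $n=3$ has basis $f_F(t)=(1,\sqrt2\sin(2\pi t),\sqrt2\cos(2\pi t))^\top$ on the domain $(-\frac12,\frac12]$ (points being taken modulo $1$), with constant variance $1$. A design consists of points $t_i$ with weights $p_i>0$, $\sum_ip_i=1$; its information matrix is $M=\sum_ip_if_F(t_i)f_F(t_i)^\top$. With $g_F=f_F'$ and $\Sigma$ positive definite, let $$\mathrm{Vol}_F(\gamma_\Sigma)=2\int_{-1/2}^{1/2}\frac{\sqrt{(f_F^\top\Sigma f_F)(g_F^\top\Sigma g_F)-(f_F^\top\Sigma g_F)^2}}{f_F^\top\Sigma f_F}\,dt .$$ A design is tube-volume optimal if $M$ is nonsingular and $\mathrm{Vol}_F(\gamma_{M^{-1}})$ is minimal among the nonsingular information matrices of all designs (equivalently, among all positive definite matrices $\int f_Ff_F^\top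 d\rho$ with $\rho$ a nonnegative finite measure on $(-\frac12,\frac12]$). A design is D-optimal if it maximizes $\det M$ among all designs. Conventions: if $\tan(\pi(t_i^0-\theta))=\pm\infty$, then $t_i=\frac12$ and $p_i$ is understood as the corresponding limit, i.e. $p_i=kq^4$. *)

theory Defs
  imports "HOL-Analysis.Analysis"
begin

definition fourier_f :: "real \<Rightarrow> real ^ 3" where
  "fourier_f t = vector [1, sqrt 2 * sin (2 * pi * t), sqrt 2 * cos (2 * pi * t)]"

definition fourier_g :: "real \<Rightarrow> real ^ 3" where
  "fourier_g t = vector_derivative fourier_f (at t)"

text \<open>A design is the finite set of its pairs (point, weight).  The points are distinct, and
  each is represented by its residue modulo 1 in the half-open interval from -1/2 to 1/2.\<close>

definition is_design :: "(real \<times> real) set \<Rightarrow> bool" where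
  "is_design \<xi> \<longleftrightarrow> finite \<xi> \<and> inj_on fst \<xi>
     \<and> (\<forall>(t, p) \<in> \<xi>. - 1/2 < t \<and> t \<le> 1/2 \<and> p > 0) \<and> (\<Sum>(t, p)\<in>\<xi>. p) = 1"

definition information_matrix :: "(real \<times> real) set \<Rightarrow> real ^ 3 ^ 3" where
  "information_matrix \<xi> = (\<Sum>(t, p)\<in>\<xi>. p *\<^sub>R (\<chi> i j. fourier_f t $ i * fourier_f t $ j))"

definition fourier_Vol :: "real ^ 3 ^ 3 \<Rightarrow> real" where
  "fourier_Vol S = 2 * integral {- 1/2 .. 1/2} (\<lambda>t.
     sqrt ((fourier_f t \<bullet> (S *v fourier_f t)) * (fourier_g t \<bullet> (S *v fourier_g t))
           - (fourier_f t \<bullet> (S *v fourier_g t))\<^sup>2)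
     / (fourier_f t \<bullet> (S *v fourier_f t)))"

definition tube_volume_optimal :: "(real \<times> real) set \<Rightarrow> bool" where
  "tube_volume_optimal \<xi> \<longleftrightarrow> is_design \<xi> \<and> invertible (information_matrix \<xi>)
     \<and> (\<forall>\<eta>. is_design \<eta> \<and> invertible (information_matrix \<eta>) \<longrightarrow>
          fourier_Vol (matrix_inv (information_matrix \<xi>))
            \<le> fourier_Vol (matrix_inv (information_matrix \<eta>)))"

definition D_optimal :: "(real \<times> real) set \<Rightarrow> bool" where
  "D_optimal \<xi> \<longleftrightarrow> is_design \<xi>
     \<and> (\<forall>\<eta>. is_design \<eta> \<longrightarrow> det (information_matrix \<eta>) \<le> det (information_matrix \<xi>))"

definition base_point :: "nat \<Rightarrow> real" where
  "base_point i = (if i = 1 then - 1/3 else if i = 2 then 0 else 1/3)"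

text \<open>In HOL, \<^term>\<open>tan x\<close> is 0 at the poles of the tangent.  They are the zeros of
  \<^term>\<open>cos\<close>, where the values at infinity are used instead: the point is 1/2, and
  the weight is the limit of the weight formula.\<close>

definition mobius_point :: "real \<Rightarrow> real \<Rightarrow> real \<Rightarrow> nat \<Rightarrow> real" where
  "mobius_point q r \<theta> i =
     (if cos (pi * (base_point i - \<theta>)) = 0 then 1/2
      else 1 / pi * arctan (q * tan (pi * (base_point i - \<theta>)) + r))"

definition mobius_raw_weight :: "real \<Rightarrow> real \<Rightarrow> real \<Rightarrow> nat \<Rightarrow> real" where
  "mobius_raw_weight q r \<theta> i =
     (if cos (pi * (base_point i - \<theta>)) = 0 then q ^ 4
      else ((1 + (q * tan (pi * (base_point i - \<theta>)) + r)\<^sup>2)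
             / (1 + (tan (pi * (base_point i - \<theta>)))\<^sup>2))\<^sup>2)"

definition mobius_weight :: "real \<Rightarrow> real \<Rightarrow> real \<Rightarrow> nat \<Rightarrow> real" where
  "mobius_weight q r \<theta> i =
     (let k = 1 / (\<Sum>j\<in>{1,2,3}. mobius_raw_weight q r \<theta> j)
      in k * mobius_raw_weight q r \<theta> i)"

definition mobius_design :: "real \<Rightarrow> real \<Rightarrow> real \<Rightarrow> (real \<times> real) set" where
  "mobius_design q r \<theta> = (\<lambda>i. (mobius_point q r \<theta> i, mobius_weight q r \<theta> i)) ` {1,2,3}"

text \<open>The representative of \<^term>\<open>x\<close> modulo 1 in the half-open interval from -1/2
  (excluded) to 1/2 (included).\<close>

definition reduce_mod1 :: "real \<Rightarrow> real" where
  "reduce_mod1 x = x - of_int \<lceil>x - 1/2\<rceil>"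

definition uniform_design :: "real \<Rightarrow> (real \<times> real) set" where
  "uniform_design \<theta> = (\<lambda>i. (reduce_mod1 (base_point i - \<theta>), 1/3)) ` {1,2,3}"

end

theory Submission
  imports Defs
begin

text \<open>
  Put \<open>x = tan (\<pi> t)\<close>.  Up to a positive factor the regression vector is then a fixed linear image of
  \<open>(1, x, x\<^sup>2)\<close>, so a design enters only through the Hankel matrix \<open>H\<close> of its moments
  \<open>m\<^sub>k = \<Sum> p cos\<^bsup>4-k\<^esup>(\<pi> t) sin\<^bsup>k\<^esup>(\<pi> t)\<close>, and the volume becomes an integral of
  \<open>sqrt (det H \<cdot> V(x)) / D(x)\<close> with the quartics
  \<open>V(x) = \<Sum> p (y - x)\<^sup>4 / (1 + y\<^sup>2)\<^sup>2\<close> and \<open>D(x) = (1, x, x\<^sup>2) adj H (1, x, x\<^sup>2)\<^sup>T\<close>.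
  This integral is invariant under the affine maps \<open>x \<mapsto> q x + r\<close>.

  Every nonsingular design can be moved by such a map to one with vanishing first trigonometric
  moment (intermediate value theorem in \<open>r\<close>).  There, with \<open>e = \<beta> cos (4 \<pi> t) + \<gamma> sin (4 \<pi> t)\<close>,
  the integrand is \<open>\<pi> sqrt (\<Delta> v) / d\<close> with \<open>v = 3/4 + e\<close> and \<open>d\<close> a constant minus \<open>e / 2\<close>.  Hoelder's
  inequality with weight \<open>1 / d\<close> bounds the integral below by an explicit algebraic function of
  \<open>\<beta>\<^sup>2 + \<gamma>\<^sup>2\<close> which exceeds its value at 0 unless \<open>\<beta> = \<gamma> = 0\<close>.  So a design is optimal exactly if an
  affine map turns its information matrix into a multiple of the identity, and a three-point
  design has such a matrix only if it is uniform on equally spaced points.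
\<close>

section \<open>Moments and affine maps\<close>

text \<open>The expanded determinant of the Hankel matrix with entries \<open>m (i + j)\<close>,
  where \<open>i\<close> and \<open>j\<close> run over 0, 1, 2.\<close>

definition hankel_det :: "(nat \<Rightarrow> real) \<Rightarrow> real" where
  "hankel_det m = m 0 * (m 2 * m 4 - (m 3)\<^sup>2) - m 1 * (m 1 * m 4 - m 2 * m 3)
     + m 2 * (m 1 * m 3 - (m 2)\<^sup>2)"

text \<open>For weights \<open>p\<close> at angles \<open>a\<close> this is the sum of
  \<open>p * (cos a * s - sin a * c) ^ 4\<close>. It is the quartic \<open>V\<close> in homogeneous
  coordinates \<open>x = s / c\<close>, so that the point at infinity \<open>c = 0\<close> needs no
  special treatment.\<close>

definition quartic_V :: "(nat \<Rightarrow> real) \<Rightarrow> real \<Rightarrow> real \<Rightarrow> real" where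
  "quartic_V m c s = m 0 * s ^ 4 - 4 * m 1 * s ^ 3 * c + 6 * m 2 * s\<^sup>2 * c\<^sup>2
     - 4 * m 3 * s * c ^ 3 + m 4 * c ^ 4"

text \<open>The bilinear form of the adjugate of the Hankel matrix. The adjugate, unlike the
  inverse, keeps the identities below polynomial.\<close>

definition adj_form :: "(nat \<Rightarrow> real) \<Rightarrow> real \<times> real \<times> real \<Rightarrow> real \<times> real \<times> real \<Rightarrow> real" where
  "adj_form m = (\<lambda>(x0, x1, x2) (y0, y1, y2).
     (m 2 * m 4 - (m 3)\<^sup>2) * x0 * y0
     + (m 2 * m 3 - m 1 * m 4) * (x0 * y1 + x1 * y0)
     + (m 1 * m 3 - (m 2)\<^sup>2) * (x0 * y2 + x2 * y0)
     + (m 0 * m 4 - (m 2)\<^sup>2) * x1 * y1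
     + (m 1 * m 2 - m 0 * m 3) * (x1 * y2 + x2 * y1)
     + (m 0 * m 2 - (m 1)\<^sup>2) * x2 * y2)"

definition quartic_D :: "(nat \<Rightarrow> real) \<Rightarrow> real \<Rightarrow> real \<Rightarrow> real" where
  "quartic_D m c s = adj_form m (c\<^sup>2, c * s, s\<^sup>2) (c\<^sup>2, c * s, s\<^sup>2)"

definition tube_density :: "(nat \<Rightarrow> real) \<Rightarrow> real \<Rightarrow> real \<Rightarrow> real" where
  "tube_density m c s = sqrt (hankel_det m * quartic_V m c s) / quartic_D m c s"

definition tube_length :: "(nat \<Rightarrow> real) \<Rightarrow> real" where
  "tube_length m = integral {- 1/2 .. 1/2} (\<lambda>t. pi * tube_density m (cos (pi * t)) (sin (pi * t)))"

text \<open>If \<open>m\<close> are the moments of a measure in the coordinate \<open>x\<close>, these are the moments of \<open>l\<close> times its image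
  under \<open>x \<mapsto> q x + r\<close>.\<close>

definition affine_moments :: "real \<Rightarrow> real \<Rightarrow> real \<Rightarrow> (nat \<Rightarrow> real) \<Rightarrow> nat \<Rightarrow> real" where
  "affine_moments l q r m k = l * (\<Sum>j\<le>k. of_nat (k choose j) * q ^ j * r ^ (k - j) * m j)"

text \<open>Moments of total mass \<open>m 0 + 2 * m 2 + m 4 = 2\<close> whose first trigonometric
  moment vanishes, that is \<open>m 0 = m 4\<close> and \<open>m 1 = - m 3\<close>. The parameters
  are one eighth of the moments of \<open>cos (4 * pi * t)\<close> and
  \<open>sin (4 * pi * t)\<close>; both vanish exactly when the information matrix is a multiple of
  the identity. Indices above 4 carry no meaning, which is why later statements are restricted to
  \<open>k \<le> 4\<close>.\<close>

definition canonical_moments :: "real \<Rightarrow> real \<Rightarrow> nat \<Rightarrow> real" where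
  "canonical_moments \<beta> \<gamma> k =
     [3/4 + \<beta>, \<gamma>, 1/4 - \<beta>, - \<gamma>, 3/4 + \<beta>] ! k"

lemma affine_moments_simps:
  "affine_moments l q r m 0 = l * m 0"
  "affine_moments l q r m 1 = l * (r * m 0 + q * m 1)"
  "affine_moments l q r m 2 = l * (r\<^sup>2 * m 0 + 2 * q * r * m 1 + q\<^sup>2 * m 2)"
  "affine_moments l q r m 3 = l * (r ^ 3 * m 0 + 3 * q * r\<^sup>2 * m 1 + 3 * q\<^sup>2 * r * m 2 + q ^ 3 * m 3)"
  "affine_moments l q r m 4 = l * (r ^ 4 * m 0 + 4 * q * r ^ 3 * m 1 + 6 * q\<^sup>2 * r\<^sup>2 * m 2
     + 4 * q ^ 3 * r * m 3 + q ^ 4 * m 4)"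
  by (simp_all add: affine_moments_def eval_nat_numeral algebra_simps)

lemma canonical_moments_simps [simp]:
  "canonical_moments \<beta> \<gamma> 0 = 3/4 + \<beta>"
  "canonical_moments \<beta> \<gamma> 1 = \<gamma>"
  "canonical_moments \<beta> \<gamma> (Suc 0) = \<gamma>"
  "canonical_moments \<beta> \<gamma> 2 = 1/4 - \<beta>"
  "canonical_moments \<beta> \<gamma> 3 = - \<gamma>"
  "canonical_moments \<beta> \<gamma> 4 = 3/4 + \<beta>"
  by (simp_all add: canonical_moments_def eval_nat_numeral)

text \<open>The map acts on \<open>(1, x, x^2)\<close> by a triangular matrix \<open>T\<close> with
  diagonal \<open>1, q, q^2\<close>, and the Hankel matrix becomes \<open>l\<close> times its
  congruence by \<open>T\<close>. This explains the powers here and in the two lemmas that follow,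
  where \<open>(c, s)\<close> moves to \<open>(c, q * s + r * c)\<close>.\<close>

lemma hankel_det_affine: "hankel_det (affine_moments l q r m) = l ^ 3 * q ^ 6 * hankel_det m"
  unfolding hankel_det_def affine_moments_simps by algebra

lemma quartic_V_affine:
  "quartic_V (affine_moments l q r m) c (q * s + r * c) = l * q ^ 4 * quartic_V m c s"
  unfolding quartic_V_def affine_moments_simps by algebra

lemma quartic_D_affine:
  "quartic_D (affine_moments l q r m) c (q * s + r * c) = l\<^sup>2 * q ^ 6 * quartic_D m c s"
  unfolding quartic_D_def adj_form_def affine_moments_simps by (simp only: prod.case) algebra

lemma hankel_det_canonical:
  "hankel_det (canonical_moments \<beta> \<gamma>) = 1/8 - 2 * (\<beta>\<^sup>2 + \<gamma>\<^sup>2)"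
  unfolding hankel_det_def canonical_moments_simps by algebra

text \<open>The root contributes \<open>l^2 * q^5\<close> and the denominator
  \<open>l^2 * q^6\<close>; what remains is \<open>1 / q\<close>, which the derivative
  \<open>q\<close> of the affine map cancels.\<close>

lemma tube_density_affine:
  assumes "q > 0" "l > 0"
  shows "q * tube_density (affine_moments l q r m) c (q * s + r * c) = tube_density m c s"
proof -
  have "sqrt (l ^ 3 * q ^ 6 * hankel_det m * (l * q ^ 4 * quartic_V m c s))
     = sqrt ((l\<^sup>2 * q ^ 5)\<^sup>2 * (hankel_det m * quartic_V m c s))"
    by (rule arg_cong[where f = sqrt]) algebra
  also have "\<dots> = l\<^sup>2 * q ^ 5 * sqrt (hankel_det m * quartic_V m c s)"
    using assms by (simp add: real_sqrt_mult)
  finally show ?thesis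
    unfolding tube_density_def hankel_det_affine quartic_V_affine quartic_D_affine
    using assms by (simp add: eval_nat_numeral)
qed

text \<open>Both quartics have degree 4, so the density has degree -2 in \<open>(c, s)\<close>. This
  is the degree that makes it an invariant integrand on the projective line.\<close>

lemma tube_density_homogeneous:
  assumes "k > 0"
  shows "tube_density m (c / sqrt k) (s / sqrt k) = k * tube_density m c s"
proof -
  define a where "a = 1 / sqrt k"
  have a: "a > 0" "a\<^sup>2 = 1 / k" using assms by (simp_all add: a_def power_divide)
  have "quartic_V m (a * c) (a * s) = (a\<^sup>2)\<^sup>2 * quartic_V m c s"
    unfolding quartic_V_def by algebra
  moreover have "quartic_D m (a * c) (a * s) = (a\<^sup>2)\<^sup>2 * quartic_D m c s"
    unfolding quartic_D_def adj_form_def prod.case by algebra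
  ultimately have "tube_density m (a * c) (a * s)
      = sqrt ((a\<^sup>2)\<^sup>2 * (hankel_det m * quartic_V m c s)) / ((a\<^sup>2)\<^sup>2 * quartic_D m c s)"
    by (simp add: tube_density_def mult_ac)
  also have "\<dots> = k * tube_density m c s"
    using assms a by (simp add: real_sqrt_mult) (simp add: tube_density_def real_sqrt_mult power2_eq_square)
  finally show ?thesis by (simp add: a_def)
qed

lemma cos_sin_four_pi:
  fixes t :: real
  shows "cos (4 * pi * t) = cos (pi * t) ^ 4 - 6 * (cos (pi * t))\<^sup>2 * (sin (pi * t))\<^sup>2 + sin (pi * t) ^ 4"
    and "sin (4 * pi * t) = 4 * cos (pi * t) ^ 3 * sin (pi * t) - 4 * cos (pi * t) * sin (pi * t) ^ 3"
proof -
  have e: "4 * pi * t = 2 * (2 * (pi * t))" by simp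
  show "cos (4 * pi * t) = cos (pi * t) ^ 4 - 6 * (cos (pi * t))\<^sup>2 * (sin (pi * t))\<^sup>2 + sin (pi * t) ^ 4"
    unfolding e cos_double[of "2 * (pi * t)"] cos_double[of "pi * t"] sin_double[of "pi * t"] by algebra
  show "sin (4 * pi * t) = 4 * cos (pi * t) ^ 3 * sin (pi * t) - 4 * cos (pi * t) * sin (pi * t) ^ 3"
    unfolding e sin_double[of "2 * (pi * t)"] cos_double[of "pi * t"] sin_double[of "pi * t"] by algebra
qed

lemma quartic_V_canonical:
  "quartic_V (canonical_moments \<beta> \<gamma>) (cos (pi * t)) (sin (pi * t))
     = 3/4 + (\<beta> * cos (4 * pi * t) + \<gamma> * sin (4 * pi * t))"
proof -
  have 1: "(cos (pi * t))\<^sup>2 = 1 - (sin (pi * t))\<^sup>2" by (rule cos_squared_eq)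
  show ?thesis
    unfolding quartic_V_def cos_sin_four_pi canonical_moments_simps using 1 by algebra
qed

lemma quartic_D_canonical:
  "quartic_D (canonical_moments \<beta> \<gamma>) (cos (pi * t)) (sin (pi * t))
     = 3/16 - (\<beta>\<^sup>2 + \<gamma>\<^sup>2) - (\<beta> * cos (4 * pi * t) + \<gamma> * sin (4 * pi * t)) / 2"
proof -
  have 1: "(cos (pi * t))\<^sup>2 = 1 - (sin (pi * t))\<^sup>2" by (rule cos_squared_eq)
  show ?thesis
    unfolding quartic_D_def adj_form_def cos_sin_four_pi canonical_moments_simps prod.case using 1 by algebra
qed

section \<open>The minimum in canonical form\<close>

text \<open>Supplies the total mass of the weight \<open>1 / d\<close> in the Hoelder bound.\<close>

lemma has_integral_inverse_trig:
  fixes A B C :: real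
  assumes A: "A > 0" and less: "B\<^sup>2 + C\<^sup>2 < A\<^sup>2"
  shows "((\<lambda>t. 1 / (A + (B * cos (4 * pi * t) + C * sin (4 * pi * t))))
           has_integral (1 / sqrt (A\<^sup>2 - (B\<^sup>2 + C\<^sup>2)))) {- 1/2 .. 1/2}"
proof -
  define w where "w = sqrt (A\<^sup>2 - (B\<^sup>2 + C\<^sup>2))"
  have w: "w > 0" "w\<^sup>2 = A\<^sup>2 - (B\<^sup>2 + C\<^sup>2)" using less by (simp_all add: w_def)
  define E where "E t = B * cos (4 * pi * t) + C * sin (4 * pi * t)" for t
  define N where "N t = B * sin (4 * pi * t) - C * cos (4 * pi * t)" for t
  have EN: "(E t)\<^sup>2 + (N t)\<^sup>2 = B\<^sup>2 + C\<^sup>2" for t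
  proof -
    have "(E t)\<^sup>2 + (N t)\<^sup>2 = (B\<^sup>2 + C\<^sup>2) * ((sin (4 * pi * t))\<^sup>2 + (cos (4 * pi * t))\<^sup>2)"
      unfolding E_def N_def by algebra
    then show ?thesis by simp
  qed
  have E_lt: "\<bar>E t\<bar> < A" for t
  proof -
    have "\<bar>E t\<bar>\<^sup>2 < A\<^sup>2" using EN[of t] less zero_le_power2[of "N t"] unfolding power2_abs by linarith
    then show ?thesis by (rule power2_less_imp_less) (use A in simp)
  qed
  \<comment> \<open>Unlike the half-angle substitution, this antiderivative has no poles: the \<open>arctan\<close> term is periodic.\<close>
  define F where "F t = 1 / (4 * pi * w) * (4 * pi * t - 2 * arctan (N t / (A + w + E t)))" for t
  have dN: "(N has_real_derivative 4 * pi * E t) (at t within T)"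
   and dE: "(E has_real_derivative - (4 * pi * N t)) (at t within T)" for t T
    unfolding N_def[abs_def] E_def[abs_def]
    by (auto intro!: derivative_eq_intros simp: algebra_simps)
  have deriv: "(F has_real_derivative 1 / (A + E t)) (at t within T)" for t T
  proof -
    define P where "P = A + w"
    have pos: "A + E t > 0" "P + E t > 0" using E_lt[of t] w A by (auto simp: P_def)
    have R: "(N t)\<^sup>2 = (A - w) * P - (E t)\<^sup>2"
      using EN[of t] w(2) unfolding P_def by algebra
    \<comment> \<open>The shift \<open>A + w\<close> in the antiderivative is chosen for this
      factorization: the derivative of \<open>arctan\<close> then has denominator
      \<open>A + E t\<close> only.\<close>
    have D: "(P + E t)\<^sup>2 + (N t)\<^sup>2 = 2 * P * (A + E t)"
      unfolding R P_def by algebra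
    have "P > 0" using w A by (simp add: P_def)
    have inv: "inverse (1 + (N t / (P + E t))\<^sup>2) = (P + E t)\<^sup>2 / (2 * P * (A + E t))"
      using pos unfolding D[symmetric] by (simp add: divide_simps power2_eq_square)
    have "(F has_real_derivative 1 / (4 * pi * w) * (4 * pi - 2 *
       (inverse (1 + (N t / (P + E t))\<^sup>2) * ((4 * pi * E t * (P + E t) - N t * (- (4 * pi * N t))) / (P + E t)\<^sup>2)))) (at t within T)"
      unfolding F_def[abs_def] P_def[symmetric]
      by (rule DERIV_cmult) (use pos in \<open>auto intro!: derivative_eq_intros dN dE simp: power2_eq_square\<close>)
    also have "4 * pi * E t * (P + E t) - N t * (- (4 * pi * N t)) = 4 * pi * (P * (E t + A - w))"
      using R by algebra
    also have "inverse (1 + (N t / (P + E t))\<^sup>2) * ((4 * pi * (P * (E t + A - w))) / (P + E t)\<^sup>2)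
       = 4 * pi * (E t + A - w) / (2 * (A + E t))"
      unfolding inv using pos \<open>P > 0\<close> by simp
    also have "1 / (4 * pi * w) * (4 * pi - 2 * (4 * pi * (E t + A - w) / (2 * (A + E t)))) = 1 / (A + E t)"
      using pos w by (simp add: field_simps)
    finally show ?thesis .
  qed
  have "((\<lambda>t. 1 / (A + E t)) has_integral (F (1/2) - F (- 1/2))) {- 1/2 .. 1/2}"
    by (rule fundamental_theorem_of_calculus)
       (auto simp: has_real_derivative_iff_has_vector_derivative[symmetric] intro: deriv)
  moreover have "F (1/2) - F (- 1/2) = 1 / w"
  proof -
    have "sin (2 * pi) = 0" "cos (2 * pi) = 1" by simp_all
    then have "N (1/2) = N (- 1/2)" "E (1/2) = E (- 1/2)" by (simp_all add: N_def E_def mult.commute)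
    then show ?thesis using w by (simp add: F_def field_simps)
  qed
  ultimately show ?thesis unfolding E_def w_def by simp
qed

lemma has_integral_trig:
  fixes A B C :: real
  shows "((\<lambda>t. A + (B * cos (4 * pi * t) + C * sin (4 * pi * t))) has_integral A) {- 1/2 .. 1/2}"
proof -
  define F where "F t = A * t + 1 / (4 * pi) * (B * sin (4 * pi * t) - C * cos (4 * pi * t))" for t
  have "((\<lambda>t. A + (B * cos (4 * pi * t) + C * sin (4 * pi * t))) has_integral (F (1/2) - F (- 1/2))) {- 1/2 .. 1/2}"
    unfolding F_def
    by (rule fundamental_theorem_of_calculus)
       (auto simp: has_real_derivative_iff_has_vector_derivative[symmetric] field_simps intro!: derivative_eq_intros)
  moreover have "sin (2 * pi) = 0" "cos (2 * pi) = 1" by simp_all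
  ultimately show ?thesis by (simp add: F_def mult.commute)
qed

text \<open>The left-hand side touches at \<open>v = a\<close>.  Integrated against a weight, with \<open>a\<close> the quotient of the
  second and first moments of \<open>v\<close>, it gives Hoelder's inequality.\<close>

lemma sqrt_ge_quadratic:
  fixes a v :: real
  assumes "a > 0" "v \<ge> 0"
  shows "(3 * a * v - v\<^sup>2) / (2 * a * sqrt a) \<le> sqrt v"
proof -
  define x y where "x = sqrt v" and "y = sqrt a"
  have xy: "x \<ge> 0" "y > 0" "v = x\<^sup>2" "a = y\<^sup>2" using assms by (auto simp: x_def y_def)
  \<comment> \<open>This product is the gap between the two sides times \<open>2 * y ^ 3\<close>;
    its double root \<open>x = y\<close> is the point of contact.\<close>
  have "0 \<le> x * ((x - y)\<^sup>2 * (x + 2 * y))" using xy by (intro mult_nonneg_nonneg) auto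
  also have "\<dots> = 2 * y ^ 3 * x - (3 * y\<^sup>2 * x\<^sup>2 - (x\<^sup>2)\<^sup>2)" by algebra
  finally have "3 * y\<^sup>2 * x\<^sup>2 - (x\<^sup>2)\<^sup>2 \<le> x * (2 * y ^ 3)" by (simp add: mult_ac)
  then have "(3 * y\<^sup>2 * x\<^sup>2 - (x\<^sup>2)\<^sup>2) / (2 * y ^ 3) \<le> x" using xy by (simp add: pos_divide_le_eq)
  moreover have "sqrt v = x" "sqrt a = y" by (simp_all add: x_def y_def)
  ultimately show ?thesis unfolding xy(3,4) using xy(1,2) by (simp add: eval_nat_numeral mult_ac)
qed

section \<open>Strict minimality of the tube length at vanishing parameters\<close>

lemma tube_length_canonical_zero: "tube_length (canonical_moments 0 0) = 2 * pi * sqrt 6 / 3"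
proof -
  have s: "sqrt (3 / 32) = sqrt 6 / 8"
  proof -
    have "sqrt (3 / 32) = sqrt (6 / 8\<^sup>2)" by simp
    also have "\<dots> = sqrt 6 / 8" by (simp only: real_sqrt_divide) simp
    finally show ?thesis .
  qed
  show ?thesis
    unfolding tube_length_def tube_density_def quartic_V_canonical quartic_D_canonical hankel_det_canonical
    by (simp add: s)
qed

text \<open>Hoelder's inequality reads: the cube of the integral of \<open>v / d\<close> is at most
  the square of the integral of \<open>sqrt v / d\<close> times the integral of
  \<open>v^2 / d\<close>. The first and the last integral are explicit, which bounds the middle one
  from below.\<close>

lemma tube_length_canonical_gt:
  assumes "hankel_det (canonical_moments \<beta> \<gamma>) > 0" and nz: "\<not> (\<beta> = 0 \<and> \<gamma> = 0)"
  shows "2 * pi * sqrt 6 / 3 < tube_length (canonical_moments \<beta> \<gamma>)"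
proof -
  define k where "k = \<beta>\<^sup>2 + \<gamma>\<^sup>2"
  define e where "e t = \<beta> * cos (4 * pi * t) + \<gamma> * sin (4 * pi * t)" for t
  define \<Delta> where "\<Delta> = 1/8 - 2 * k"
  define K where "K = 9/16 - k"
  define A where "A = 3/16 - k"
  define Z where "Z = sqrt ((1/16 - k) * (9/16 - k))"
  \<comment> \<open>All quantities below are rational functions of \<open>z\<close>, and \<open>k = 0\<close> corresponds to \<open>z = 1/3\<close>.\<close>
  define z where "z = Z / K"
  \<comment> \<open>The upper bound is exactly the positivity of the Hankel determinant; it makes
    \<open>v\<close> and \<open>d\<close> positive.\<close>
  have k: "0 < k" "k < 1/16"
    using assms unfolding hankel_det_canonical k_def
    by (auto simp: sum_power2_gt_zero_iff)
  have \<Delta>: "\<Delta> > 0" and K: "K > 0" and A: "A > 0" using k by (auto simp: \<Delta>_def K_def A_def)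
  have Z2: "Z\<^sup>2 = (1/16 - k) * K" and Zpos: "Z > 0" using k by (auto simp: Z_def K_def)
  have z: "z > 0" using Zpos K by (simp add: z_def)
  have z2: "z\<^sup>2 * K = 1/16 - k" using Z2 K by (simp add: z_def power_divide power2_eq_square)
  have Kz: "2 * (1 - z\<^sup>2) * K = 1" using z2 by (simp add: algebra_simps K_def)
  have z3: "z < 1/3"
  proof -
    have "z\<^sup>2 * K < K / 9" using z2 K_def k by linarith
    then have "z\<^sup>2 * K < (1/3)\<^sup>2 * K" by (simp add: power_divide)
    then have "z\<^sup>2 < (1/3)\<^sup>2" using K mult_less_cancel_right_pos by blast
    then show ?thesis by (rule power2_less_imp_less) simp
  qed
  define d where "d t = A - e t / 2" for t
  define v where "v t = 3/4 + e t" for t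
  \<comment> \<open>Since \<open>v\<close> is affine in \<open>d\<close>, the functions
    \<open>v / d\<close> and \<open>v^2 / d\<close> are combinations of \<open>1 / d\<close>,
    constants and \<open>d\<close>.\<close>
  have vd: "v t = 2 * (K - d t)" for t by (simp add: v_def d_def K_def A_def)
  have e2: "\<bar>e t\<bar> \<le> sqrt k" for t
  proof -
    have "(e t)\<^sup>2 + (\<beta> * sin (4 * pi * t) - \<gamma> * cos (4 * pi * t))\<^sup>2
       = (\<beta>\<^sup>2 + \<gamma>\<^sup>2) * ((sin (4 * pi * t))\<^sup>2 + (cos (4 * pi * t))\<^sup>2)"
      unfolding e_def by algebra
    then have "(e t)\<^sup>2 \<le> k" by (simp add: k_def) (metis add_increasing2 le_add_same_cancel1 order_refl zero_le_power2)
    then have "sqrt ((e t)\<^sup>2) \<le> sqrt k" by (rule real_sqrt_le_mono)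
    then show ?thesis by simp
  qed
  have rho: "sqrt k < 1/4"
  proof -
    have "sqrt k < sqrt ((1/4)\<^sup>2)" using k by (intro real_sqrt_less_mono) (simp add: power2_eq_square)
    then show ?thesis by simp
  qed
  have d: "d t > 0" for t
  proof -
    \<comment> \<open>The product is \<open>A - sqrt k / 2\<close>, a lower bound for
      \<open>d\<close> because \<open>e\<close> is at most \<open>sqrt k\<close> in absolute
      value.\<close>
    have "0 < (1/4 - sqrt k) * (3/4 + sqrt k)" using rho k by (intro mult_pos_pos) (auto intro: add_pos_pos)
    also have "\<dots> = A - sqrt k / 2" using k by (simp add: A_def algebra_simps)
    also have "\<dots> \<le> d t" using e2[of t] by (simp add: d_def)
    finally show ?thesis .
  qed
  have v: "v t > 0" for t using e2[of t] rho by (simp add: v_def)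
  have d_alt: "d = (\<lambda>t. A + (- \<beta> / 2 * cos (4 * pi * t) + - \<gamma> / 2 * sin (4 * pi * t)))"
    by (auto simp: fun_eq_iff d_def e_def field_simps)
  have int_d: "(d has_integral A) {- 1/2 .. 1/2}"
    unfolding d_alt by (rule has_integral_trig)
  have int_inv: "((\<lambda>t. 1 / d t) has_integral (1 / Z)) {- 1/2 .. 1/2}"
  proof -
    have eq: "A\<^sup>2 - ((- \<beta> / 2)\<^sup>2 + (- \<gamma> / 2)\<^sup>2) = (1/16 - k) * (9/16 - k)"
      unfolding A_def k_def by algebra
    have "(1/16 - k) * (9/16 - k) > 0" using k by simp
    then have "(- \<beta> / 2)\<^sup>2 + (- \<gamma> / 2)\<^sup>2 < A\<^sup>2" using eq by linarith
    from has_integral_inverse_trig[OF A this] show ?thesis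
      unfolding eq Z_def d_alt .
  qed
  \<comment> \<open>\<open>X\<close> and \<open>Y\<close> are the integrals of \<open>v / d\<close>
    and \<open>v^2 / d\<close>, with \<open>1 / Z\<close> the integral of \<open>1 / d\<close> and
    \<open>A\<close> that of \<open>d\<close>. Their quotient \<open>a\<close> is the best point of
    contact for \<open>sqrt_ge_quadratic\<close>.\<close>
  define X where "X = 2 * (K * (1 / Z) - 1)"
  define Y where "Y = 4 * (K\<^sup>2 * (1 / Z) - 2 * K + A)"
  define a where "a = Y / X"
  have KZ: "K * (1 / Z) = 1 / z" "K\<^sup>2 * (1 / Z) = K / z"
    using K Zpos by (simp_all add: z_def power2_eq_square)
  have X_eq: "X = 2 * (1 - z) / z" unfolding X_def KZ using z by (simp add: field_simps)
  have X: "X > 0" using z z3 by (simp add: X_eq)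
  have zz: "z\<^sup>2 < 1" using z3 z by (simp add: power_less_one_iff)
  have K_eq: "K = 1 / (2 * (1 - z\<^sup>2))" using Kz zz by (simp add: field_simps)
  have Y_eq: "Y = (4 - 3 * z - 3 * z\<^sup>2) / (2 * z * (1 + z))"
  proof -
    have AK: "A = K - 3/8" by (simp add: A_def K_def)
    then have "Y * z = 4 * K * (1 - z) - 3/2 * z" unfolding Y_def KZ AK using z by (simp add: field_simps)
    then have "Y * z * (2 * (1 - z\<^sup>2)) = 4 * (1 - z) - 3 * z * (1 - z\<^sup>2)" using Kz by algebra
    then have "(1 - z) * (Y * (2 * z * (1 + z))) = (1 - z) * (4 - 3 * z - 3 * z\<^sup>2)" by algebra
    then have "Y * (2 * z * (1 + z)) = 4 - 3 * z - 3 * z\<^sup>2" using z3 by simp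
    then show ?thesis using z by (intro eq_divide_imp) auto
  qed
  have quad: "4 - 3 * z - 3 * z\<^sup>2 > 0" using z3 zz by simp
  have Y: "Y > 0" unfolding Y_eq using z quad by simp
  have a: "a > 0" using X Y by (simp add: a_def)
  \<comment> \<open>This is \<open>sqrt_ge_quadratic\<close> divided by \<open>d\<close> and
    integrated.\<close>
  have lower: "pi * sqrt \<Delta> / (2 * a * sqrt a) * (3 * a * X - Y) \<le> tube_length (canonical_moments \<beta> \<gamma>)"
  proof -
    let ?c = "pi * sqrt \<Delta> / (2 * a * sqrt a)"
    have c: "?c \<ge> 0" using \<Delta> a by simp
    have "((\<lambda>t. ?c * (3 * a * (2 * (K * (1 / d t) - 1)) - 4 * (K\<^sup>2 * (1 / d t) - 2 * K + d t)))
       has_integral ?c * (3 * a * X - Y)) {- 1/2 .. 1/2}"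
      unfolding X_def Y_def
      by (intro has_integral_mult_right has_integral_diff has_integral_add int_d int_inv)
         (use has_integral_const_real[of _ "- 1/2" "1/2 :: real"] in \<open>simp_all\<close>)
    moreover have "((\<lambda>t. pi * (sqrt (\<Delta> * v t) / d t)) has_integral tube_length (canonical_moments \<beta> \<gamma>)) {- 1/2 .. 1/2}"
    proof -
      have "continuous_on {- 1/2 .. 1/2} (\<lambda>t. pi * (sqrt (\<Delta> * v t) / d t))"
        using d unfolding v_def d_def e_def
        by (intro continuous_intros) (auto simp: less_imp_neq[THEN not_sym])
      then show ?thesis
        unfolding tube_length_def tube_density_def quartic_V_canonical quartic_D_canonical hankel_det_canonical
          has_integral_iff v_def d_def e_def \<Delta>_def k_def A_def
        by (auto intro: integrable_continuous_real)
    qed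
    moreover have "?c * (3 * a * (2 * (K * (1 / d t) - 1)) - 4 * (K\<^sup>2 * (1 / d t) - 2 * K + d t))
       \<le> pi * (sqrt (\<Delta> * v t) / d t)" for t
    proof -
      have "3 * a * (2 * (K * (1 / d t) - 1)) - 4 * (K\<^sup>2 * (1 / d t) - 2 * K + d t)
          = (3 * a * v t - (v t)\<^sup>2) / d t"
        using d[of t] unfolding vd by (simp add: field_simps power2_eq_square)
      then have "?c * (3 * a * (2 * (K * (1 / d t) - 1)) - 4 * (K\<^sup>2 * (1 / d t) - 2 * K + d t))
          = pi * sqrt \<Delta> / d t * ((3 * a * v t - (v t)\<^sup>2) / (2 * a * sqrt a))" by simp
      also have "\<dots> \<le> pi * sqrt \<Delta> / d t * sqrt (v t)"
        using sqrt_ge_quadratic[OF a, of "v t"] v[of t] d[of t] \<Delta> by (intro mult_left_mono) auto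
      finally show ?thesis by (simp add: real_sqrt_mult)
    qed
    ultimately show ?thesis by (blast intro: has_integral_le)
  qed
  have "(2 * pi * sqrt 6 / 3)\<^sup>2 < (pi * sqrt \<Delta> / (2 * a * sqrt a) * (3 * a * X - Y))\<^sup>2"
  proof -
    \<comment> \<open>For this \<open>a\<close> the bound collapses to
      \<open>pi * sqrt \<Delta> * X / sqrt a\<close>, whose square is \<open>pi^2\<close> times a
      rational function of \<open>z\<close>, to be compared with \<open>8 / 3\<close>.\<close>
    have aX: "Y = a * X" using X by (simp add: a_def)
    have "pi * sqrt \<Delta> / (2 * a * sqrt a) * (3 * a * X - Y) = pi * sqrt \<Delta> * X / sqrt a"
      unfolding aX using a by (simp add: field_simps)
    then have "(pi * sqrt \<Delta> / (2 * a * sqrt a) * (3 * a * X - Y))\<^sup>2 = pi\<^sup>2 * (\<Delta> * X\<^sup>2 / a)"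
      using \<Delta> a by (simp add: power_mult_distrib power_divide)
    moreover have "2 / 3 * 4 < \<Delta> * X\<^sup>2 / a"
    proof -
      have D: "\<Delta> * ((1 - z) * (1 + z)) = z\<^sup>2"
        using Kz z2 unfolding \<Delta>_def by algebra
      have "\<Delta> * X\<^sup>2 / a = 16 * (\<Delta> * ((1 - z) * (1 + z))) * (1 - z)\<^sup>2 / (z\<^sup>2 * (4 - 3 * z - 3 * z\<^sup>2))"
      proof -
        define Q where "Q = 4 - 3 * z - 3 * z\<^sup>2"
        show ?thesis unfolding a_def X_eq Y_eq using z z3 quad unfolding Q_def[symmetric]
          by (simp add: field_simps eval_nat_numeral)
      qed
      also have "\<dots> = 16 * (1 - z)\<^sup>2 / (4 - 3 * z - 3 * z\<^sup>2)" unfolding D using z by simp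
      finally have eq: "\<Delta> * X\<^sup>2 / a = 16 * (1 - z)\<^sup>2 / (4 - 3 * z - 3 * z\<^sup>2)" .
      \<comment> \<open>The final comparison reduces to this product; its first factor is positive
        because \<open>k > 0\<close> gives \<open>z < 1/3\<close>.\<close>
      have "0 < (1 - 3 * z) * (2 - 3 * z)" using z3 by simp
      also have "\<dots> = (6 * (1 - z)\<^sup>2 - (4 - 3 * z - 3 * z\<^sup>2))" by algebra
      finally show ?thesis unfolding eq using quad by (simp add: field_simps)
    qed
    then have "pi\<^sup>2 * (2 / 3 * 4) < pi\<^sup>2 * (\<Delta> * X\<^sup>2 / a)" by (intro mult_strict_left_mono) auto
    moreover have "(2 * pi * sqrt 6 / 3)\<^sup>2 = pi\<^sup>2 * (2 / 3 * 4)" by (simp add: power_mult_distrib power_divide)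
    ultimately show ?thesis by (simp only:)
  qed
  then have "2 * pi * sqrt 6 / 3 < pi * sqrt \<Delta> / (2 * a * sqrt a) * (3 * a * X - Y)"
  proof (rule power2_less_imp_less)
    show "0 \<le> pi * sqrt \<Delta> / (2 * a * sqrt a) * (3 * a * X - Y)"
      using X a \<Delta> by (simp add: a_def)
  qed
  then show ?thesis using lower by linarith
qed

section \<open>Affine invariance and reduction to canonical form\<close>

text \<open>Substitution along the map induced on angles by \<open>x \<mapsto> q * x + r\<close>
  with \<open>x = tan (pi * t)\<close>. The Jacobian \<open>q / R\<close> meets the factor
  \<open>R\<close> from homogeneity and the factor \<open>1 / q\<close> from
  \<open>tube_density_affine\<close>. The assumption on \<open>quartic_D\<close> makes the integrand
  continuous.\<close>

lemma tube_length_affine: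
  assumes q: "q > 0" and l: "l > 0"
    and D: "\<And>c s. c\<^sup>2 + s\<^sup>2 = 1 \<Longrightarrow> quartic_D (affine_moments l q r m) c s \<noteq> 0"
  shows "tube_length (affine_moments l q r m) = tube_length m"
proof -
  let ?m = "affine_moments l q r m"
  define f where "f t = pi * tube_density ?m (cos (pi * t)) (sin (pi * t))" for t
  define R where "R t = (cos (pi * t))\<^sup>2 + (q * sin (pi * t) + r * cos (pi * t))\<^sup>2" for t
  \<comment> \<open>The endpoints stand for \<open>x\<close> at plus and minus infinity, which an
    increasing affine map fixes. \<open>R\<close> is the squared length of the image
    \<open>(c, q * s + r * c)\<close> of the unit vector \<open>(c, s)\<close>.\<close>
  define g where "g t = (if \<bar>t\<bar> < 1/2 then arctan (q * tan (pi * t) + r) / pi else t)" for t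
  define g' where "g' t = q / R t" for t
  have cos_pos: "cos (pi * t) > 0" if "\<bar>t\<bar> < 1/2" for t
  proof (rule cos_gt_zero_pi)
    have "pi * (- 1/2) < pi * t" "pi * t < pi * (1/2)"
      using that by (intro mult_strict_left_mono; simp add: abs_less_iff)+
    then show "- (pi / 2) < pi * t" "pi * t < pi / 2" by simp_all
  qed
  have angle: "cos (pi * g t) = cos (pi * t) / sqrt (R t)"
      "sin (pi * g t) = (q * sin (pi * t) + r * cos (pi * t)) / sqrt (R t)"
    if "t \<in> {- 1/2 .. 1/2}" for t
  proof -
    have "cos (pi * g t) = cos (pi * t) / sqrt (R t)
      \<and> sin (pi * g t) = (q * sin (pi * t) + r * cos (pi * t)) / sqrt (R t)"
    proof (cases "\<bar>t\<bar> < 1/2")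
      case True
      define c s where "c = cos (pi * t)" and "s = sin (pi * t)"
      have c: "c > 0" using cos_pos[OF True] by (simp add: c_def)
      define X where "X = q * tan (pi * t) + r"
      have X: "X = (q * s + r * c) / c" using c by (simp add: X_def tan_def c_def s_def field_simps)
      have "1 + X\<^sup>2 = R t / c\<^sup>2"
        unfolding X R_def c_def[symmetric] s_def[symmetric] using c by (simp add: power_divide field_simps)
      then have "sqrt (1 + X\<^sup>2) = sqrt (R t) / c" using c by (simp add: real_sqrt_divide)
      moreover have "pi * g t = arctan X" using True by (simp add: g_def X_def)
      ultimately show ?thesis unfolding c_def[symmetric] s_def[symmetric]
        using c by (simp add: cos_arctan sin_arctan X)
    next
      case False
      with that have "t = 1/2 \<or> t = - 1/2" by auto
      then have "pi * t = pi / 2 \<or> pi * t = - (pi / 2)" by (elim disjE) simp_all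
      then have "cos (pi * t) = 0" "sin (pi * t) = 1 \<or> sin (pi * t) = - 1" by (metis cos_pi_half cos_minus, metis sin_pi_half sin_minus)
      then show ?thesis using False q by (auto simp: g_def R_def real_sqrt_mult)
    qed
    then show "cos (pi * g t) = cos (pi * t) / sqrt (R t)"
      "sin (pi * g t) = (q * sin (pi * t) + r * cos (pi * t)) / sqrt (R t)" by auto
  qed
  have R: "R t > 0" for t
  proof (cases "cos (pi * t) = 0")
    case True
    then have "(sin (pi * t))\<^sup>2 = 1" using sin_cos_squared_add[of "pi * t"] by simp
    then show ?thesis using q True by (simp add: R_def power_mult_distrib)
  next
    case False
    then show ?thesis by (simp add: R_def add_pos_nonneg)
  qed
  \<comment> \<open>\<open>g\<close> is defined separately at the endpoints, so its continuity there
    has to come from the behaviour of \<open>tan\<close> and \<open>arctan\<close> at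
    infinity.\<close>
  have lim_right: "(g \<longlongrightarrow> g (1/2)) (at_left (1/2))"
  proof -
    have "filterlim (\<lambda>t. pi * t) (at_left (pi/2)) (at_left (1/2))"
    proof -
      have "((\<lambda>t. pi * t) \<longlongrightarrow> pi * (1/2)) (at_left (1/2))" by (intro tendsto_intros)
      moreover have "eventually (\<lambda>t. pi * t \<in> {..<pi/2} \<and> pi * t \<noteq> pi/2) (at_left (1/2))"
        by (auto simp: eventually_at_filter)
      ultimately show ?thesis by (simp add: filterlim_at)
    qed
    then have "filterlim (\<lambda>t. tan (pi * t)) at_top (at_left (1/2))"
      by (rule filterlim_compose[OF filterlim_tan_at_left])
    then have "filterlim (\<lambda>t. q * tan (pi * t) + r) at_top (at_left (1/2))"
      unfolding add.commute[of _ r]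
      by (intro filterlim_tendsto_add_at_top[OF tendsto_const] filterlim_tendsto_pos_mult_at_top[OF tendsto_const q])
    then have "((\<lambda>t. arctan (q * tan (pi * t) + r)) \<longlongrightarrow> pi/2) (at_left (1/2))"
      by (rule filterlim_compose[OF tendsto_arctan_at_top])
    then have "((\<lambda>t. arctan (q * tan (pi * t) + r) / pi) \<longlongrightarrow> pi/2 / pi) (at_left (1/2))"
      by (intro tendsto_intros) auto
    moreover have "eventually (\<lambda>t. arctan (q * tan (pi * t) + r) / pi = g t) (at_left (1/2))"
      using eventually_at_left_real[of 0 "1/2"] by (auto elim!: eventually_mono simp: g_def)
    ultimately have "(g \<longlongrightarrow> pi/2 / pi) (at_left (1/2))" by (rule Lim_transform_eventually)
    then show ?thesis by (simp add: g_def)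
  qed
  have lim_left: "(g \<longlongrightarrow> g (- 1/2)) (at_right (- 1/2))"
  proof -
    have "filterlim (\<lambda>t. pi * t) (at_right (- (pi/2))) (at_right (- 1/2))"
    proof -
      have "((\<lambda>t. pi * t) \<longlongrightarrow> pi * (- 1/2)) (at_right (- 1/2))" by (intro tendsto_intros)
      moreover have "eventually (\<lambda>t. pi * t \<in> {- (pi/2)<..} \<and> pi * t \<noteq> - (pi/2)) (at_right (- 1/2))"
        using eventually_at_right_less[of "- 1/2 :: real"]
      proof eventually_elim
        fix t :: real assume "- 1/2 < t"
        then have "pi * (- 1/2) < pi * t" by (intro mult_strict_left_mono) auto
        then show "pi * t \<in> {- (pi/2)<..} \<and> pi * t \<noteq> - (pi/2)" by simp
      qed
      ultimately show ?thesis by (simp add: filterlim_at)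
    qed
    then have "filterlim (\<lambda>t. tan (pi * t)) at_bot (at_right (- 1/2))"
      by (rule filterlim_compose[OF filterlim_tan_at_right])
    then have "filterlim (\<lambda>t. q * tan (pi * t) + r) at_bot (at_right (- 1/2))"
      unfolding add.commute[of _ r]
      by (intro filterlim_tendsto_add_at_bot_iff[OF tendsto_const, THEN iffD2] filterlim_tendsto_pos_mult_at_bot[OF tendsto_const q])
    then have "((\<lambda>t. arctan (q * tan (pi * t) + r)) \<longlongrightarrow> - (pi/2)) (at_right (- 1/2))"
      by (rule filterlim_compose[OF tendsto_arctan_at_bot])
    then have "((\<lambda>t. arctan (q * tan (pi * t) + r) / pi) \<longlongrightarrow> - (pi/2) / pi) (at_right (- 1/2))"
      by (intro tendsto_intros) auto
    moreover have "eventually (\<lambda>t. arctan (q * tan (pi * t) + r) / pi = g t) (at_right (- 1/2))"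
      using eventually_at_right_real[of "- 1/2" 0] by (auto elim!: eventually_mono simp: g_def)
    ultimately have "(g \<longlongrightarrow> - (pi/2) / pi) (at_right (- 1/2))" by (rule Lim_transform_eventually)
    then show ?thesis by (simp add: g_def)
  qed
  have deriv: "(g has_real_derivative g' t) (at t)" if t: "\<bar>t\<bar> < 1/2" for t
  proof -
    have c: "cos (pi * t) > 0" by (rule cos_pos[OF t])
    have "((\<lambda>t. arctan (q * tan (pi * t) + r) / pi) has_real_derivative
        inverse (1 + (q * tan (pi * t) + r)\<^sup>2) * (q * (inverse ((cos (pi * t))\<^sup>2) * pi)) / pi) (at t)"
      using c by (auto intro!: derivative_eq_intros)
    also have "inverse (1 + (q * tan (pi * t) + r)\<^sup>2) * (q * (inverse ((cos (pi * t))\<^sup>2) * pi)) / pi = g' t"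
    proof -
      have "R t = (cos (pi * t))\<^sup>2 * (1 + (q * tan (pi * t) + r)\<^sup>2)"
        using c by (simp add: R_def tan_def power2_eq_square field_simps)
      then show ?thesis by (simp add: g'_def divide_inverse mult_ac)
    qed
    finally have *: "((\<lambda>t. arctan (q * tan (pi * t) + r) / pi) has_real_derivative g' t) (at t)" .
    show ?thesis
      by (rule has_field_derivative_transform_within_open[OF *, where S = "{- 1/2 <..< 1/2}"])
         (use t in \<open>auto simp: g_def abs_less_iff\<close>)
  qed
  have "continuous_on {- 1/2 .. 1/2} g"
    unfolding continuous_on_eq_continuous_within
  proof
    fix t :: real assume t: "t \<in> {- 1/2 .. 1/2}"
    consider "\<bar>t\<bar> < 1/2" | "t = 1/2" | "t = - 1/2" using t by fastforce
    then show "continuous (at t within {- 1/2 .. 1/2}) g"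
    proof cases
      case 1
      then show ?thesis using DERIV_isCont[OF deriv[OF 1]] continuous_at_imp_continuous_at_within by blast
    next
      case 2
      have "at (1/2) within {- 1/2 .. 1/2} = at_left (1/2 :: real)" by (rule at_within_Icc_at_left) simp
      then show ?thesis using lim_right unfolding continuous_within 2 by metis
    next
      case 3
      have "at (- 1/2) within {- 1/2 .. 1/2} = at_right (- 1/2 :: real)" by (rule at_within_Icc_at_right) simp
      then show ?thesis using lim_left unfolding continuous_within 3 by metis
    qed
  qed
  moreover have "continuous_on {- 1/2 .. 1/2} f"
    unfolding f_def tube_density_def
  proof (intro continuous_intros ballI)
    show "quartic_D ?m (cos (pi * t)) (sin (pi * t)) \<noteq> 0" for t by (rule D) simp
  qed (auto simp: quartic_V_def quartic_D_def adj_form_def intro!: continuous_intros)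
  moreover have "g ` {- 1/2 .. 1/2} \<subseteq> {- 1/2 .. 1/2}"
  proof -
    have "- 1/2 \<le> arctan x / pi \<and> arctan x / pi \<le> 1/2" for x
      using arctan_bounded[of x] by (simp add: field_simps)
    then show ?thesis by (auto simp: g_def)
  qed
  \<comment> \<open>The endpoints form the exceptional set of the substitution rule: continuity of
    \<open>g\<close> suffices there.\<close>
  ultimately have "((\<lambda>t. g' t *\<^sub>R f (g t)) has_integral integral {g (- 1/2) .. g (1/2)} f) {- 1/2 .. 1/2}"
  proof (intro has_integral_substitution_strong[where s = "{- 1/2, 1/2}"])
    show "(g has_real_derivative g' x) (at x within {- 1/2..1/2})" if "x \<in> {- 1/2..1/2} - {- 1/2, 1/2}" for x
      using that by (intro has_field_derivative_at_within[OF deriv]) (auto simp: abs_less_iff)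
  qed (auto simp: g_def)
  moreover have "g' t *\<^sub>R f (g t) = pi * tube_density m (cos (pi * t)) (sin (pi * t))"
    if "t \<in> {- 1/2 .. 1/2}" for t
  proof -
    have "g' t *\<^sub>R f (g t) = pi * (q * tube_density ?m (cos (pi * t)) (q * sin (pi * t) + r * cos (pi * t)))"
      unfolding f_def angle[OF that] tube_density_homogeneous[OF R] g'_def using R[of t] by simp
    then show ?thesis unfolding tube_density_affine[OF q l] .
  qed
  ultimately have "((\<lambda>t. pi * tube_density m (cos (pi * t)) (sin (pi * t)))
      has_integral integral {g (- 1/2) .. g (1/2)} f) {- 1/2 .. 1/2}"
    by (rule has_integral_eq[rotated])
  then show ?thesis unfolding tube_length_def f_def[symmetric]
    by (simp add: g_def has_integral_iff)
qed

section \<open>Positive definite Hankel matrices\<close>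

definition positive_moments :: "(nat \<Rightarrow> real) \<Rightarrow> bool" where
  "positive_moments m \<longleftrightarrow> (\<forall>x y z. (x, y, z) \<noteq> (0, 0, 0) \<longrightarrow>
     0 < m 0 * x\<^sup>2 + 2 * m 1 * x * y + m 2 * (2 * x * z + y\<^sup>2) + 2 * m 3 * y * z + m 4 * z\<^sup>2)"

lemma positive_momentsD:
  assumes "positive_moments m" "(x, y, z) \<noteq> (0, 0, 0)"
  shows "0 < m 0 * x\<^sup>2 + 2 * m 1 * x * y + m 2 * (2 * x * z + y\<^sup>2) + 2 * m 3 * y * z + m 4 * z\<^sup>2"
  using assms unfolding positive_moments_def by blast

lemma positive_moments_outer:
  assumes "positive_moments m"
  shows "m 0 > 0" "m 4 > 0"
  using positive_momentsD[OF assms, of 1 0 0] positive_momentsD[OF assms, of 0 0 1] by simp_all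

text \<open>\<open>V\<close> is the value of the Hankel form at
  \<open>(s^2, - 2 * s * c, c^2)\<close>, the coefficients of a squared linear form.\<close>

lemma quartic_V_pos:
  assumes "positive_moments m" "(c, s) \<noteq> (0, 0)"
  shows "quartic_V m c s > 0"
proof -
  have "(s\<^sup>2, - 2 * s * c, c\<^sup>2) \<noteq> (0, 0, 0)" using assms(2) by auto
  from positive_momentsD[OF assms(1) this] show ?thesis
    by (simp add: quartic_V_def power2_eq_square power3_eq_cube power4_eq_xxxx algebra_simps)
qed

text \<open>With \<open>y\<close> the adjugate applied to \<open>x\<close>, the Hankel matrix sends
  \<open>y\<close> to \<open>hankel_det m\<close> times \<open>x\<close>, so its form at
  \<open>y\<close> is \<open>hankel_det m\<close> times the adjugate form at
  \<open>x\<close>.\<close>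

lemma adj_form_pos:
  assumes m: "positive_moments m" and det: "hankel_det m > 0" and x: "x \<noteq> (0, 0, 0)"
  shows "adj_form m x x > 0"
proof -
  obtain x0 x1 x2 where xe: "x = (x0, x1, x2)" by (cases x) auto
  define y0 where "y0 = (m 2 * m 4 - (m 3)\<^sup>2) * x0 + (m 2 * m 3 - m 1 * m 4) * x1 + (m 1 * m 3 - (m 2)\<^sup>2) * x2"
  define y1 where "y1 = (m 2 * m 3 - m 1 * m 4) * x0 + (m 0 * m 4 - (m 2)\<^sup>2) * x1 + (m 1 * m 2 - m 0 * m 3) * x2"
  define y2 where "y2 = (m 1 * m 3 - (m 2)\<^sup>2) * x0 + (m 1 * m 2 - m 0 * m 3) * x1 + (m 0 * m 2 - (m 1)\<^sup>2) * x2"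
  have H: "m 0 * y0 + m 1 * y1 + m 2 * y2 = hankel_det m * x0"
     "m 1 * y0 + m 2 * y1 + m 3 * y2 = hankel_det m * x1"
     "m 2 * y0 + m 3 * y1 + m 4 * y2 = hankel_det m * x2"
    unfolding y0_def y1_def y2_def hankel_det_def by algebra+
  have "(y0, y1, y2) \<noteq> (0, 0, 0)" using H det x by (auto simp: xe)
  from positive_momentsD[OF m this]
  have "0 < y0 * (m 0 * y0 + m 1 * y1 + m 2 * y2) + y1 * (m 1 * y0 + m 2 * y1 + m 3 * y2)
      + y2 * (m 2 * y0 + m 3 * y1 + m 4 * y2)"
    by (simp add: power2_eq_square algebra_simps)
  also have "\<dots> = hankel_det m * (x0 * y0 + x1 * y1 + x2 * y2)"
    unfolding H by (simp add: algebra_simps)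
  also have "x0 * y0 + x1 * y1 + x2 * y2 = adj_form m x x"
    unfolding xe adj_form_def y0_def y1_def y2_def prod.case by algebra
  finally show ?thesis using det by (simp add: zero_less_mult_iff)
qed

text \<open>Evaluating the Hankel form at the first column of the adjugate gives the minor
  \<open>a\<close> times the determinant; \<open>a\<close> itself is positive by evaluation at
  \<open>(0, m 4, - m 3)\<close>.\<close>

lemma hankel_det_pos:
  assumes m: "positive_moments m"
  shows "hankel_det m > 0"
proof -
  define a where "a = m 2 * m 4 - (m 3)\<^sup>2"
  have m4: "m 4 > 0" using positive_moments_outer[OF m] by simp
  then have "0 < m 2 * (m 4)\<^sup>2 + 2 * m 3 * m 4 * (- m 3) + m 4 * (m 3)\<^sup>2"
    using positive_momentsD[OF m, of 0 "m 4" "- m 3"] by simp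
  also have "\<dots> = m 4 * a" unfolding a_def by algebra
  finally have a: "a > 0" using m4 by (simp add: zero_less_mult_iff)
  have "0 < a * hankel_det m"
  proof -
    have "(a, m 2 * m 3 - m 1 * m 4, m 1 * m 3 - (m 2)\<^sup>2) \<noteq> (0, 0, 0)" using a by simp
    from positive_momentsD[OF m this] have "0 < m 0 * a\<^sup>2 + 2 * m 1 * a * (m 2 * m 3 - m 1 * m 4)
      + m 2 * (2 * a * (m 1 * m 3 - (m 2)\<^sup>2) + (m 2 * m 3 - m 1 * m 4)\<^sup>2)
      + 2 * m 3 * (m 2 * m 3 - m 1 * m 4) * (m 1 * m 3 - (m 2)\<^sup>2) + m 4 * (m 1 * m 3 - (m 2)\<^sup>2)\<^sup>2" .
    also have "\<dots> = a * hankel_det m" unfolding a_def hankel_det_def by algebra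
    finally show ?thesis .
  qed
  then show ?thesis using a by (simp add: zero_less_mult_iff)
qed

lemma quartic_D_pos:
  assumes "positive_moments m" "(c, s) \<noteq> (0, 0)"
  shows "quartic_D m c s > 0"
  unfolding quartic_D_def
  by (rule adj_form_pos) (use assms hankel_det_pos in auto)

section \<open>Reduction to canonical form\<close>

lemma cubic_eventually_nonpos:
  fixes a b c d :: real
  assumes "a > 0"
  shows "\<exists>R>0. \<forall>r\<ge>R. d + c * r + b * r\<^sup>2 - a * r ^ 3 \<le> 0"
proof (intro exI conjI allI impI)
  define R where "R = 1 + (\<bar>b\<bar> + \<bar>c\<bar> + \<bar>d\<bar>) / a"
  show "R > 0" using assms by (auto simp: R_def intro: add_pos_nonneg)
  fix r assume r: "r \<ge> R"
  have r1: "r \<ge> 1" using r assms by (auto simp: R_def) (smt (verit) divide_nonneg_pos)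
  have "a * r \<ge> \<bar>b\<bar> + \<bar>c\<bar> + \<bar>d\<bar>" using r assms by (simp add: R_def field_simps)
  then have "(\<bar>b\<bar> + \<bar>c\<bar> + \<bar>d\<bar>) * r\<^sup>2 \<le> a * r * r\<^sup>2" by (intro mult_right_mono) auto
  moreover have "b * r\<^sup>2 \<le> \<bar>b\<bar> * r\<^sup>2" by (intro mult_right_mono) auto
  moreover have "c * r \<le> \<bar>c\<bar> * r\<^sup>2"
    using r1 by (intro mult_mono) (auto simp: power2_eq_square)
  moreover have "d * 1 \<le> \<bar>d\<bar> * r\<^sup>2"
    using r1 by (intro mult_mono) auto
  ultimately show "d + c * r + b * r\<^sup>2 - a * r ^ 3 \<le> 0"
    by (simp add: power2_eq_square power3_eq_cube algebra_simps)
qed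

lemma tube_length_cong:
  assumes "\<And>k. k \<le> 4 \<Longrightarrow> m k = m' k"
  shows "tube_length m = tube_length m'"
  using assms by (simp add: tube_length_def tube_density_def hankel_det_def quartic_V_def
      quartic_D_def adj_form_def)

lemma hankel_det_cong:
  assumes "\<And>k. k \<le> 4 \<Longrightarrow> m k = m' k"
  shows "hankel_det m = hankel_det m'"
  using assms by (simp add: hankel_det_def)

lemma quartic_D_cong:
  assumes "\<And>k. k \<le> 4 \<Longrightarrow> m k = m' k"
  shows "quartic_D m c s = quartic_D m' c s"
  using assms by (simp add: quartic_D_def adj_form_def)

lemma all_le_4: "(\<forall>k\<le>4. P k) \<longleftrightarrow> P 0 \<and> P 1 \<and> P 2 \<and> P 3 \<and> P (4::nat)"
  by (auto simp: le_Suc_eq numeral_eq_Suc)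

text \<open>Undoing a translation by \<open>r\<close> and a scaling by \<open>q\<close> must produce
  \<open>m 0 = m 4\<close> and \<open>m 1 = - m 3\<close>. The first condition determines
  \<open>q\<close> from \<open>r\<close>, and the second is then an equation in \<open>r\<close>
  alone.\<close>

lemma canonical_form_exists:
  assumes m: "positive_moments m"
  shows "\<exists>l>0. \<exists>q>0. \<exists>r \<beta> \<gamma>. \<forall>k\<le>4. m k = affine_moments l q r (canonical_moments \<beta> \<gamma>) k"
proof -
  have m0: "m 0 > 0" using positive_moments_outer[OF m] by simp
  \<comment> \<open>\<open>s1\<close> to \<open>s4\<close> are the moments after translation by
    \<open>- r\<close>, and \<open>m 0\<close> stays fixed. With \<open>q ^ 4 = s4 r / m 0\<close>
    the condition on the odd moments becomes \<open>h r = 0\<close>.\<close>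
  define s1 where "s1 r = m 1 - r * m 0" for r
  define s2 where "s2 r = m 2 - 2 * r * m 1 + r\<^sup>2 * m 0" for r
  define s3 where "s3 r = m 3 - 3 * r * m 2 + 3 * r\<^sup>2 * m 1 - r ^ 3 * m 0" for r
  define s4 where "s4 r = m 4 - 4 * r * m 3 + 6 * r\<^sup>2 * m 2 - 4 * r ^ 3 * m 1 + r ^ 4 * m 0" for r
  define h where "h r = s3 r + s1 r * sqrt (s4 r / m 0)" for r
  have s2: "s2 r > 0" for r
    using positive_momentsD[OF m, of "- r" 1 0] by (simp add: s2_def algebra_simps)
  have s4: "s4 r > 0" for r
    using quartic_V_pos[OF m, of 1 r] by (simp add: s4_def quartic_V_def algebra_simps)
  have "\<exists>r. h r = 0"
  proof -
    obtain R1 where R1: "R1 > 0" "\<And>r. r \<ge> R1 \<Longrightarrow> m 3 + (- 3 * m 2) * r + (3 * m 1) * r\<^sup>2 - m 0 * r ^ 3 \<le> 0"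
      using cubic_eventually_nonpos[OF m0] by blast
    obtain R2 where R2: "R2 > 0" "\<And>r. r \<ge> R2 \<Longrightarrow> - m 3 + (- 3 * m 2) * r + (- 3 * m 1) * r\<^sup>2 - m 0 * r ^ 3 \<le> 0"
      using cubic_eventually_nonpos[OF m0] by blast
    \<comment> \<open>\<open>R\<close> is so large that \<open>s1\<close> and \<open>s3\<close>
      share a sign at \<open>R\<close>, and the opposite sign at \<open>- R\<close>; the square root
      cannot spoil the sign of \<open>h\<close>.\<close>
    define R where "R = max (max R1 R2) (\<bar>m 1\<bar> / m 0)"
    have R: "R \<ge> R1" "R \<ge> R2" "R \<ge> \<bar>m 1\<bar> / m 0" "R > 0" using R1(1) by (auto simp: R_def)
    have "R * m 0 \<ge> \<bar>m 1\<bar>" using R(3) m0 by (simp add: pos_divide_le_eq)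
    then have s1: "s1 R \<le> 0" "s1 (- R) \<ge> 0" by (auto simp: s1_def)
    have s3: "s3 R \<le> 0" "s3 (- R) \<ge> 0"
      using R1(2)[OF R(1)] R2(2)[OF R(2)] by (simp_all add: s3_def algebra_simps)
    have nn: "sqrt (s4 r / m 0) \<ge> 0" for r using s4[of r] m0 by simp
    have "h R \<le> 0" using s1(1) s3(1) nn[of R] unfolding h_def by (intro add_nonpos_nonpos mult_nonpos_nonneg)
    moreover have "0 \<le> h (- R)" using s1(2) s3(2) nn[of "- R"] unfolding h_def by (intro add_nonneg_nonneg mult_nonneg_nonneg)
    moreover have "continuous_on {- R .. R} h"
      using m0 unfolding h_def s1_def s3_def s4_def by (intro continuous_intros) auto
    ultimately show ?thesis using IVT2'[of h R 0 "- R"] R(4) by auto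
  qed
  then obtain r where r: "h r = 0" by blast
  define q where "q = sqrt (sqrt (s4 r / m 0))"
  have q: "q > 0" using s4[of r] m0 by (simp add: q_def)
  have q2: "q\<^sup>2 = sqrt (s4 r / m 0)" using s4[of r] m0 by (simp add: q_def)
  have "q ^ 4 = (q\<^sup>2)\<^sup>2" by algebra
  then have q4: "q ^ 4 * m 0 = s4 r" unfolding q2 using s4[of r] m0 by simp
  have q3: "s3 r = - q\<^sup>2 * s1 r" using r unfolding h_def q2 by (simp add: eq_neg_iff_add_eq_0 mult.commute)
  define c1 where "c1 = s1 r / q"
  define c2 where "c2 = s2 r / q\<^sup>2"
  \<comment> \<open>After scaling, the outer moments both equal \<open>m 0\<close> and the middle
    one is \<open>c2\<close>, so \<open>l\<close> is half the total mass, as the normalization to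
    mass 2 demands.\<close>
  define l where "l = m 0 + c2"
  have c: "q * c1 = s1 r" "q\<^sup>2 * c2 = s2 r" "q ^ 3 * c1 = - s3 r"
    using q by (simp_all add: c1_def c2_def q3 eval_nat_numeral)
  have l: "l > 0" using m0 s2[of r] q by (simp add: l_def c2_def add_pos_nonneg)
  define \<beta> \<gamma> where "\<beta> = m 0 / l - 3/4" and "\<gamma> = c1 / l"
  define a b where "a = 3/4 + \<beta>" and "b = 1/4 - \<beta>"
  have e: "l * a = m 0" "l * \<gamma> = c1" "l * b = c2"
    using l by (simp_all add: \<beta>_def \<gamma>_def a_def b_def l_def field_simps)
  have "m k = affine_moments l q r (canonical_moments \<beta> \<gamma>) k" if "k \<le> 4" for k
  proof -
    have "\<forall>k\<le>4. m k = affine_moments l q r (canonical_moments \<beta> \<gamma>) k"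
      unfolding all_le_4 affine_moments_simps canonical_moments_simps a_def[symmetric] b_def[symmetric]
    proof (intro conjI)
      show "m 0 = l * a" using e by simp
      have "l * (r * a + q * \<gamma>) = r * (l * a) + q * (l * \<gamma>)" by algebra
      then show "m 1 = l * (r * a + q * \<gamma>)" unfolding e c s1_def by simp
      have "l * (r\<^sup>2 * a + 2 * q * r * \<gamma> + q\<^sup>2 * b)
          = r\<^sup>2 * (l * a) + 2 * r * (q * (l * \<gamma>)) + q\<^sup>2 * (l * b)" by algebra
      then show "m 2 = l * (r\<^sup>2 * a + 2 * q * r * \<gamma> + q\<^sup>2 * b)"
        unfolding e c s1_def s2_def by (simp add: algebra_simps power2_eq_square)
      have "l * (r ^ 3 * a + 3 * q * r\<^sup>2 * \<gamma> + 3 * q\<^sup>2 * r * b + q ^ 3 * (- \<gamma>))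
          = r ^ 3 * (l * a) + 3 * r\<^sup>2 * (q * (l * \<gamma>)) + 3 * r * (q\<^sup>2 * (l * b)) - q ^ 3 * (l * \<gamma>)"
        by algebra
      then show "m 3 = l * (r ^ 3 * a + 3 * q * r\<^sup>2 * \<gamma> + 3 * q\<^sup>2 * r * b + q ^ 3 * (- \<gamma>))"
        unfolding e c s1_def s2_def s3_def by (simp add: algebra_simps eval_nat_numeral)
      have "l * (r ^ 4 * a + 4 * q * r ^ 3 * \<gamma> + 6 * q\<^sup>2 * r\<^sup>2 * b + 4 * q ^ 3 * r * (- \<gamma>) + q ^ 4 * a)
          = r ^ 4 * (l * a) + 4 * r ^ 3 * (q * (l * \<gamma>)) + 6 * r\<^sup>2 * (q\<^sup>2 * (l * b))
            - 4 * r * (q ^ 3 * (l * \<gamma>)) + q ^ 4 * (l * a)"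
        by algebra
      then show "m 4 = l * (r ^ 4 * a + 4 * q * r ^ 3 * \<gamma> + 6 * q\<^sup>2 * r\<^sup>2 * b
          + 4 * q ^ 3 * r * (- \<gamma>) + q ^ 4 * a)"
        unfolding e c q4 s1_def s2_def s3_def s4_def by (simp add: algebra_simps eval_nat_numeral)
    qed
    then show ?thesis using that by blast
  qed
  then show ?thesis using l q by blast
qed

text \<open>Up to an affine map and a factor, the information matrix is a multiple of the
  identity.\<close>

definition isotropic_moments :: "(nat \<Rightarrow> real) \<Rightarrow> bool" where
  "isotropic_moments m \<longleftrightarrow>
     (\<exists>l>0. \<exists>q>0. \<exists>r. \<forall>k\<le>4. m k = affine_moments l q r (canonical_moments 0 0) k)"

lemma tube_length_affine_cong:
  assumes m: "positive_moments m" and "l > 0" "q > 0"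
    and eq: "\<And>k. k \<le> 4 \<Longrightarrow> m k = affine_moments l q r m' k"
  shows "tube_length m = tube_length m'" and "hankel_det m' > 0"
proof -
  have "quartic_D (affine_moments l q r m') c s \<noteq> 0" if "c\<^sup>2 + s\<^sup>2 = 1" for c s
  proof -
    have "quartic_D m c s = quartic_D (affine_moments l q r m') c s"
      by (rule quartic_D_cong) (rule eq)
    moreover have "(c, s) \<noteq> (0, 0)" using that by auto
    ultimately show ?thesis using quartic_D_pos[OF m, of c s] by simp
  qed
  then show "tube_length m = tube_length m'"
    using tube_length_affine[OF assms(3,2)] by (subst tube_length_cong[OF eq]) auto
  show "hankel_det m' > 0"
  proof -
    have "hankel_det m = hankel_det (affine_moments l q r m')"
      by (rule hankel_det_cong) (rule eq)
    also have "\<dots> = l ^ 3 * q ^ 6 * hankel_det m'" by (rule hankel_det_affine)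
    finally have "0 < l ^ 3 * q ^ 6 * hankel_det m'" using hankel_det_pos[OF m] by simp
    moreover have "l ^ 3 * q ^ 6 > 0" using assms(2,3) by simp
    ultimately show ?thesis by (simp only: zero_less_mult_pos)
  qed
qed

lemma tube_length_isotropic:
  assumes "positive_moments m" "isotropic_moments m"
  shows "tube_length m = 2 * pi * sqrt 6 / 3"
proof -
  obtain l q r where "l > 0" "q > 0" "\<forall>k\<le>4. m k = affine_moments l q r (canonical_moments 0 0) k"
    using assms(2) unfolding isotropic_moments_def by blast
  then have "tube_length m = tube_length (canonical_moments 0 0)"
    by (intro tube_length_affine_cong[OF assms(1)]) auto
  then show ?thesis unfolding tube_length_canonical_zero .
qed

lemma tube_length_non_isotropic:
  assumes m: "positive_moments m" and "\<not> isotropic_moments m"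
  shows "2 * pi * sqrt 6 / 3 < tube_length m"
proof -
  obtain l q r \<beta> \<gamma> where lq: "l > 0" "q > 0"
    and eq: "\<forall>k\<le>4. m k = affine_moments l q r (canonical_moments \<beta> \<gamma>) k"
    using canonical_form_exists[OF m] by blast
  then have "\<not> (\<beta> = 0 \<and> \<gamma> = 0)"
    using assms(2) unfolding isotropic_moments_def by blast
  moreover have "tube_length m = tube_length (canonical_moments \<beta> \<gamma>)"
    by (rule tube_length_affine_cong(1)[OF m lq]) (use eq in auto)
  moreover have "hankel_det (canonical_moments \<beta> \<gamma>) > 0"
    by (rule tube_length_affine_cong(2)[OF m lq]) (use eq in auto)
  ultimately show ?thesis using tube_length_canonical_gt by simp
qed

section \<open>Moments of designs\<close>

definition design_moments :: "(real \<times> real) set \<Rightarrow> nat \<Rightarrow> real" where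
  "design_moments \<xi> k = (\<Sum>(t, p)\<in>\<xi>. p * cos (pi * t) ^ (4 - k) * sin (pi * t) ^ k)"

lemma fourier_f_cos_sin:
  defines "C \<equiv> \<lambda>t. cos (pi * t)" and "S \<equiv> \<lambda>t. sin (pi * t)"
  shows "fourier_f t = vector [1, 2 * sqrt 2 * (C t * S t), sqrt 2 * ((C t)\<^sup>2 - (S t)\<^sup>2)]"
proof -
  have e: "2 * pi * t = 2 * (pi * t)" by simp
  show ?thesis unfolding fourier_f_def e sin_double cos_double C_def S_def by (simp add: mult_ac)
qed

lemma fourier_g_cos_sin:
  defines "C \<equiv> \<lambda>t. cos (pi * t)" and "S \<equiv> \<lambda>t. sin (pi * t)"
  shows "fourier_g t = vector [0, 2 * pi * sqrt 2 * ((C t)\<^sup>2 - (S t)\<^sup>2), - 4 * pi * sqrt 2 * (C t * S t)]"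
proof -
  have f: "fourier_f = (\<lambda>t. axis 1 1 + (sqrt 2 * sin (2 * pi * t)) *\<^sub>R axis 2 1
      + (sqrt 2 * cos (2 * pi * t)) *\<^sub>R axis 3 1)"
    by (simp add: fun_eq_iff fourier_f_def vec_eq_iff forall_3 axis_def)
  have "(fourier_f has_vector_derivative
      (sqrt 2 * (cos (2 * pi * t) * (2 * pi))) *\<^sub>R axis 2 1
      + (sqrt 2 * (- sin (2 * pi * t) * (2 * pi))) *\<^sub>R axis 3 1) (at t)"
    unfolding f by (auto intro!: derivative_eq_intros simp: mult_ac)
  then have "fourier_g t = (sqrt 2 * (cos (2 * pi * t) * (2 * pi))) *\<^sub>R axis 2 1
      + (sqrt 2 * (- sin (2 * pi * t) * (2 * pi))) *\<^sub>R axis 3 1"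
    unfolding fourier_g_def by (rule vector_derivative_at)
  moreover have e: "2 * pi * t = 2 * (pi * t)" by simp
  ultimately show ?thesis
    unfolding e sin_double cos_double C_def S_def by (simp add: vec_eq_iff forall_3 axis_def)
qed

section \<open>The information matrix and its inverse through the Hankel matrix\<close>

definition basis_change :: "real ^ 3 ^ 3" where
  "basis_change = vector [vector [1, 0, 1], vector [0, 2 * sqrt 2, 0], vector [sqrt 2, 0, - sqrt 2]]"

lemma fourier_f_basis_change:
  "fourier_f t = basis_change *v vector [(cos (pi * t))\<^sup>2, cos (pi * t) * sin (pi * t), (sin (pi * t))\<^sup>2]"
  unfolding fourier_f_cos_sin
  by (simp add: vec_eq_iff forall_3 matrix_vector_mult_def sum_3 basis_change_def algebra_simps)

lemma fourier_g_basis_change: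
  "fourier_g t = basis_change *v vector [- 2 * pi * (cos (pi * t) * sin (pi * t)),
     pi * ((cos (pi * t))\<^sup>2 - (sin (pi * t))\<^sup>2), 2 * pi * (cos (pi * t) * sin (pi * t))]"
  unfolding fourier_g_cos_sin
  by (simp add: vec_eq_iff forall_3 matrix_vector_mult_def sum_3 basis_change_def algebra_simps)

definition basis_change_inv :: "real ^ 3 ^ 3" where
  "basis_change_inv = vector [vector [1/2, 0, sqrt 2 / 4], vector [0, sqrt 2 / 4, 0],
     vector [1/2, 0, - sqrt 2 / 4]]"

definition hankel_matrix :: "(nat \<Rightarrow> real) \<Rightarrow> real ^ 3 ^ 3" where
  "hankel_matrix m = vector [vector [m 0, m 1, m 2], vector [m 1, m 2, m 3], vector [m 2, m 3, m 4]]"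

definition hankel_adj :: "(nat \<Rightarrow> real) \<Rightarrow> real ^ 3 ^ 3" where
  "hankel_adj m = vector
    [vector [m 2 * m 4 - (m 3)\<^sup>2, m 2 * m 3 - m 1 * m 4, m 1 * m 3 - (m 2)\<^sup>2],
     vector [m 2 * m 3 - m 1 * m 4, m 0 * m 4 - (m 2)\<^sup>2, m 1 * m 2 - m 0 * m 3],
     vector [m 1 * m 3 - (m 2)\<^sup>2, m 1 * m 2 - m 0 * m 3, m 0 * m 2 - (m 1)\<^sup>2]]"

lemma hankel_matrix_adj: "hankel_matrix m ** hankel_adj m = hankel_det m *\<^sub>R mat 1"
  by (simp add: vec_eq_iff forall_3 matrix_matrix_mult_def sum_3 hankel_matrix_def hankel_adj_def
      hankel_det_def mat_def algebra_simps power2_eq_square)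

lemma basis_change_right_inv: "basis_change ** basis_change_inv = mat 1"
  by (simp add: vec_eq_iff forall_3 matrix_matrix_mult_def sum_3 basis_change_def basis_change_inv_def mat_def)

lemma basis_change_left_inv: "basis_change_inv ** basis_change = mat 1"
  using basis_change_right_inv matrix_left_right_inverse by blast

lemma information_matrix_component:
  "information_matrix \<xi> $ i $ j = (\<Sum>(t, p)\<in>\<xi>. p * (fourier_f t $ i * fourier_f t $ j))"
  by (simp add: information_matrix_def sum_component case_prod_unfold)

text \<open>The rank-one matrix of \<open>(c^2, c * s, s^2)\<close> with itself has entries
  depending only on the sum of the indices, hence is a Hankel matrix; the change of basis acts by
  congruence.\<close>

lemma information_matrix_eq:
  "information_matrix \<xi> = basis_change ** hankel_matrix (design_moments \<xi>) ** transpose basis_change"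
proof -
  define H where "H t = hankel_matrix (\<lambda>k. cos (pi * t) ^ (4 - k) * sin (pi * t) ^ k)" for t
  have 1: "(\<chi> i j. fourier_f t $ i * fourier_f t $ j) = basis_change ** H t ** transpose basis_change" for t
    unfolding fourier_f_basis_change
    by (simp add: vec_eq_iff forall_3 matrix_matrix_mult_def matrix_vector_mult_def sum_3 basis_change_def
        H_def hankel_matrix_def transpose_def eval_nat_numeral algebra_simps)
  have 2: "hankel_matrix (design_moments \<xi>) = (\<Sum>(t, p)\<in>\<xi>. p *\<^sub>R H t)"
    by (simp add: vec_eq_iff forall_3 H_def hankel_matrix_def design_moments_def sum_component
        case_prod_unfold mult.assoc)
  have "information_matrix \<xi> = (\<Sum>(t, p)\<in>\<xi>. p *\<^sub>R (basis_change ** H t ** transpose basis_change))"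
    unfolding information_matrix_def 1 ..
  also have "\<dots> = basis_change ** (\<Sum>(t, p)\<in>\<xi>. p *\<^sub>R H t) ** transpose basis_change"
    by (simp add: vec_eq_iff forall_3 matrix_matrix_mult_def sum_3 case_prod_unfold sum_component
        sum_distrib_left sum_distrib_right sum.distrib algebra_simps)
  finally show ?thesis unfolding 2 .
qed

text \<open>\<open>matrix_inv\<close> is a choice term, so an explicit inverse is exhibited in order
  to evaluate it.\<close>

lemma information_matrix_inverse:
  assumes "hankel_det (design_moments \<xi>) \<noteq> 0"
  shows "information_matrix \<xi> ** (transpose basis_change_inv **
       ((1 / hankel_det (design_moments \<xi>)) *\<^sub>R hankel_adj (design_moments \<xi>)) ** basis_change_inv) = mat 1"
proof -
  let ?m = "design_moments \<xi>"
  have t: "transpose basis_change ** transpose basis_change_inv = mat 1"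
    unfolding matrix_transpose_mul[symmetric] basis_change_left_inv by (rule transpose_mat)
  have "information_matrix \<xi> ** (transpose basis_change_inv ** ((1 / hankel_det ?m) *\<^sub>R hankel_adj ?m) ** basis_change_inv)
    = basis_change ** (hankel_matrix ?m ** (transpose basis_change ** transpose basis_change_inv)
        ** ((1 / hankel_det ?m) *\<^sub>R hankel_adj ?m)) ** basis_change_inv"
    unfolding information_matrix_eq by (simp only: matrix_mul_assoc)
  also have "hankel_matrix ?m ** (transpose basis_change ** transpose basis_change_inv)
        ** ((1 / hankel_det ?m) *\<^sub>R hankel_adj ?m) = mat 1"
  proof -
    have "hankel_matrix ?m ** ((1 / hankel_det ?m) *\<^sub>R hankel_adj ?m)
        = (1 / hankel_det ?m) *\<^sub>R (hankel_matrix ?m ** hankel_adj ?m)"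
      by (simp add: vec_eq_iff forall_3 matrix_matrix_mult_def sum_3 algebra_simps add_divide_distrib)
    then show ?thesis unfolding t hankel_matrix_adj using assms by simp
  qed
  finally show ?thesis by (simp add: basis_change_right_inv)
qed

lemma invertible_information_matrix:
  assumes "hankel_det (design_moments \<xi>) \<noteq> 0"
  shows "invertible (information_matrix \<xi>)"
  using information_matrix_inverse[OF assms] invertible_right_inverse by blast

lemma matrix_inv_eqI:
  fixes A :: "'a :: field ^ 'n ^ 'n"
  assumes "A ** B = mat 1"
  shows "matrix_inv A = B"
  unfolding matrix_inv_def
proof (rule some_equality)
  show "A ** B = mat 1 \<and> B ** A = mat 1" using assms matrix_left_right_inverse by blast
  show "C = B" if "A ** C = mat 1 \<and> C ** A = mat 1" for C
    using that assms by (metis matrix_mul_assoc matrix_mul_lid matrix_mul_rid)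
qed

lemma matrix_inv_information_matrix:
  assumes "hankel_det (design_moments \<xi>) \<noteq> 0"
  shows "matrix_inv (information_matrix \<xi>) = transpose basis_change_inv **
       ((1 / hankel_det (design_moments \<xi>)) *\<^sub>R hankel_adj (design_moments \<xi>)) ** basis_change_inv"
  by (rule matrix_inv_eqI[OF information_matrix_inverse[OF assms]])

lemma inner_information_matrix_inv:
  fixes x y :: "real ^ 3"
  assumes "hankel_det (design_moments \<xi>) \<noteq> 0"
    and "x = basis_change *v vector [x0, x1, x2]" "y = basis_change *v vector [y0, y1, y2]"
  shows "x \<bullet> (matrix_inv (information_matrix \<xi>) *v y)
     = adj_form (design_moments \<xi>) (x0, x1, x2) (y0, y1, y2) / hankel_det (design_moments \<xi>)"
proof -
  have inv: "basis_change_inv *v (basis_change *v v) = v" for v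
    by (simp add: matrix_vector_mul_assoc basis_change_left_inv)
  have "x \<bullet> (matrix_inv (information_matrix \<xi>) *v y)
     = (basis_change_inv *v x) \<bullet> (((1 / hankel_det (design_moments \<xi>)) *\<^sub>R hankel_adj (design_moments \<xi>)) *v (basis_change_inv *v y))"
    unfolding matrix_inv_information_matrix[OF assms(1)] matrix_vector_mul_assoc[symmetric]
    by (metis dot_lmul_matrix vector_transpose_matrix)
  also have "\<dots> = adj_form (design_moments \<xi>) (x0, x1, x2) (y0, y1, y2) / hankel_det (design_moments \<xi>)"
  proof -
    have "vector [x0, x1, x2] \<bullet> (hankel_adj (design_moments \<xi>) *v vector [y0, y1, y2])
        = adj_form (design_moments \<xi>) (x0, x1, x2) (y0, y1, y2)"
      by (simp add: inner_vec_def matrix_vector_mult_def sum_3 hankel_adj_def adj_form_def algebra_simps)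
    then show ?thesis
      unfolding assms(2,3) inv scaleR_matrix_vector_assoc[symmetric] inner_scaleR_right by simp
  qed
  finally show ?thesis .
qed

text \<open>The Hankel form is the weighted sum of the squares of \<open>\<phi>\<close>. If it
  vanished, \<open>\<phi>\<close> would be zero at every design point and its coefficient vector
  would lie in the kernel of the information matrix.\<close>

lemma positive_design_moments:
  assumes \<xi>: "is_design \<xi>" and inv: "invertible (information_matrix \<xi>)"
  shows "positive_moments (design_moments \<xi>)"
  unfolding positive_moments_def
proof (intro allI impI)
  fix x y z :: real
  assume nz: "(x, y, z) \<noteq> (0, 0, 0)"
  define \<phi> where "\<phi> t = x * (cos (pi * t))\<^sup>2 + y * (cos (pi * t) * sin (pi * t)) + z * (sin (pi * t))\<^sup>2" for t
  \<comment> \<open>The coordinates of \<open>\<phi>\<close> in the Fourier basis, namely the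
    transpose of \<open>basis_change_inv\<close> applied to \<open>(x, y, z)\<close>.\<close>
  define w :: "real ^ 3" where "w = vector [(x + z) / 2, y * sqrt 2 / 4, (x - z) * sqrt 2 / 4]"
  have fin: "finite \<xi>" and pos: "\<And>t p. (t, p) \<in> \<xi> \<Longrightarrow> p > 0"
    using \<xi> unfolding is_design_def by auto
  have w: "fourier_f t \<bullet> w = \<phi> t" for t
  proof -
    define a where "a = sqrt (2 :: real)"
    have "fourier_f t \<bullet> w = (x + z) / 2 + a\<^sup>2 * (y * (cos (pi * t) * sin (pi * t)) / 2
        + (x - z) * ((cos (pi * t))\<^sup>2 - (sin (pi * t))\<^sup>2) / 4)"
      unfolding fourier_f_cos_sin w_def a_def[symmetric]
      by (simp add: inner_vec_def sum_3 power2_eq_square[of a] algebra_simps add_divide_distrib diff_divide_distrib)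
    also have "\<dots> = (x + z) / 2 * ((cos (pi * t))\<^sup>2 + (sin (pi * t))\<^sup>2) + y * (cos (pi * t) * sin (pi * t))
        + (x - z) / 2 * ((cos (pi * t))\<^sup>2 - (sin (pi * t))\<^sup>2)"
      unfolding sin_cos_squared_add2 by (simp add: a_def)
    also have "\<dots> = \<phi> t"
    proof -
      have "(x + z) / 2 * (A + B) + y * D + (x - z) / 2 * (A - B) = x * A + y * D + z * B" for A B D :: real
        by (simp add: field_simps)
      then show ?thesis unfolding \<phi>_def .
    qed
    finally show ?thesis .
  qed
  have eq: "design_moments \<xi> 0 * x\<^sup>2 + 2 * design_moments \<xi> 1 * x * y
      + design_moments \<xi> 2 * (2 * x * z + y\<^sup>2) + 2 * design_moments \<xi> 3 * y * z + design_moments \<xi> 4 * z\<^sup>2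
     = (\<Sum>(t, p)\<in>\<xi>. p * (\<phi> t)\<^sup>2)"
    unfolding design_moments_def case_prod_unfold sum_distrib_right sum_distrib_left sum.distrib[symmetric]
    by (rule sum.cong) (simp_all add: \<phi>_def eval_nat_numeral algebra_simps)
  have nn: "0 \<le> p * (\<phi> t)\<^sup>2" if "(t, p) \<in> \<xi>" for t p using pos[OF that] by simp
  have "(\<Sum>(t, p)\<in>\<xi>. p * (\<phi> t)\<^sup>2) \<noteq> 0"
  proof
    assume "(\<Sum>(t, p)\<in>\<xi>. p * (\<phi> t)\<^sup>2) = 0"
    then have "\<forall>(t, p)\<in>\<xi>. p * (\<phi> t)\<^sup>2 = 0"
      using sum_nonneg_eq_0_iff[OF fin, of "\<lambda>(t, p). p * (\<phi> t)\<^sup>2"] nn by fastforce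
    then have zero: "\<phi> t = 0" if "(t, p) \<in> \<xi>" for t p using that pos[OF that] by fastforce
    have "information_matrix \<xi> *v w = 0"
    proof -
      have "(information_matrix \<xi> *v w) $ i = (\<Sum>(t, p)\<in>\<xi>. p * fourier_f t $ i * (fourier_f t \<bullet> w))" for i
        by (simp add: matrix_vector_mult_def information_matrix_component sum_3 inner_vec_def
            sum_distrib_right sum_distrib_left sum.distrib[symmetric] case_prod_unfold algebra_simps)
      moreover have "(\<Sum>(t, p)\<in>\<xi>. p * fourier_f t $ i * (fourier_f t \<bullet> w)) = 0" for i
        by (rule sum.neutral) (auto simp: w zero)
      ultimately show ?thesis by (simp add: vec_eq_iff)
    qed
    then have "w = 0"
      using inv by (metis invertible_def matrix_vector_mul_assoc matrix_vector_mul_lid matrix_vector_mult_0_right)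
    then have "x + z = 0" "y = 0" "x - z = 0" by (simp_all add: w_def vec_eq_iff forall_3)
    then show False using nz by simp
  qed
  moreover have "(\<Sum>(t, p)\<in>\<xi>. p * (\<phi> t)\<^sup>2) \<ge> 0" by (rule sum_nonneg) (auto intro: nn)
  ultimately show "0 < design_moments \<xi> 0 * x\<^sup>2 + 2 * design_moments \<xi> 1 * x * y
      + design_moments \<xi> 2 * (2 * x * z + y\<^sup>2) + 2 * design_moments \<xi> 3 * y * z + design_moments \<xi> 4 * z\<^sup>2"
    unfolding eq by linarith
qed

text \<open>In the basis \<open>(c^2, c * s, s^2)\<close> the inverse information matrix is the
  Hankel adjugate over \<open>hankel_det\<close>; one such factor cancels between root and
  denominator.\<close>

lemma fourier_Vol_eq:
  assumes "is_design \<xi>" "invertible (information_matrix \<xi>)"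
  shows "fourier_Vol (matrix_inv (information_matrix \<xi>)) = 2 * tube_length (design_moments \<xi>)"
proof -
  let ?m = "design_moments \<xi>"
  let ?S = "matrix_inv (information_matrix \<xi>)"
  have det: "hankel_det ?m > 0" using hankel_det_pos positive_design_moments assms by blast
  have "sqrt ((fourier_f t \<bullet> (?S *v fourier_f t)) * (fourier_g t \<bullet> (?S *v fourier_g t))
           - (fourier_f t \<bullet> (?S *v fourier_g t))\<^sup>2)
     / (fourier_f t \<bullet> (?S *v fourier_f t)) = pi * tube_density ?m (cos (pi * t)) (sin (pi * t))" for t
  proof -
    define c s where "c = cos (pi * t)" and "s = sin (pi * t)"
    have cs: "c\<^sup>2 + s\<^sup>2 = 1" by (simp add: c_def s_def)
    let ?F = "(c\<^sup>2, c * s, s\<^sup>2)"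
    let ?G = "(- 2 * pi * (c * s), pi * (c\<^sup>2 - s\<^sup>2), 2 * pi * (c * s))"
    have f: "fourier_f t = basis_change *v vector [c\<^sup>2, c * s, s\<^sup>2]"
      unfolding c_def s_def by (rule fourier_f_basis_change)
    have g: "fourier_g t = basis_change *v vector [- 2 * pi * (c * s), pi * (c\<^sup>2 - s\<^sup>2), 2 * pi * (c * s)]"
      unfolding c_def s_def by (rule fourier_g_basis_change)
    \<comment> \<open>A Gram determinant of the adjugate form is \<open>hankel_det\<close> times the
      Hankel form at the cross product of the two vectors. That cross product is
      \<open>pi * (c^2 + s^2)\<close> times \<open>(s^2, - 2 * s * c, c^2)\<close>, where the Hankel
      form is \<open>V\<close>.\<close>
    have id: "adj_form ?m ?F ?F * adj_form ?m ?G ?G - (adj_form ?m ?F ?G)\<^sup>2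
        = pi\<^sup>2 * (hankel_det ?m * quartic_V ?m c s)"
    proof -
      have "adj_form ?m ?F ?F * adj_form ?m ?G ?G - (adj_form ?m ?F ?G)\<^sup>2
        = pi\<^sup>2 * (c\<^sup>2 + s\<^sup>2)\<^sup>2 * (hankel_det ?m * quartic_V ?m c s)"
        unfolding adj_form_def prod.case hankel_det_def quartic_V_def by algebra
      then show ?thesis using cs by simp
    qed
    have "sqrt ((adj_form ?m ?F ?F / hankel_det ?m) * (adj_form ?m ?G ?G / hankel_det ?m)
           - (adj_form ?m ?F ?G / hankel_det ?m)\<^sup>2)
       = sqrt (pi\<^sup>2 * (hankel_det ?m * quartic_V ?m c s) / (hankel_det ?m)\<^sup>2)"
      unfolding id[symmetric] by (simp add: power2_eq_square diff_divide_distrib)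
    also have "\<dots> = pi * sqrt (hankel_det ?m * quartic_V ?m c s) / hankel_det ?m"
      using det by (simp add: real_sqrt_divide real_sqrt_mult)
    finally show ?thesis
      unfolding inner_information_matrix_inv[OF det[THEN less_imp_neq, THEN not_sym] f f]
        inner_information_matrix_inv[OF det[THEN less_imp_neq, THEN not_sym] f g]
        inner_information_matrix_inv[OF det[THEN less_imp_neq, THEN not_sym] g g]
        tube_density_def c_def[symmetric] s_def[symmetric] quartic_D_def
      using det by simp
  qed
  then show ?thesis unfolding fourier_Vol_def tube_length_def by simp
qed

section \<open>Three-point designs\<close>

text \<open>Negative \<open>q\<close> adds nothing: the odd canonical moments vanish at zero
  parameters, so only even powers of \<open>q\<close> survive.\<close>

lemma isotropic_momentsI:
  assumes "q \<noteq> 0" "l > 0" "\<forall>k\<le>4. m k = affine_moments l q r (canonical_moments 0 0) k"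
  shows "isotropic_moments m"
proof -
  have "q ^ 4 = \<bar>q\<bar> ^ 4" by simp
  then have "\<forall>k\<le>4. m k = affine_moments l \<bar>q\<bar> r (canonical_moments 0 0) k"
    using assms(3) unfolding all_le_4 affine_moments_simps by simp
  then show ?thesis using assms(1,2) unfolding isotropic_moments_def by (metis zero_less_abs_iff)
qed

lemma hankel_det_isotropic:
  assumes "isotropic_moments m"
  shows "hankel_det m > 0"
proof -
  obtain l q r where lq: "l > 0" "q > 0" and eq: "\<forall>k\<le>4. m k = affine_moments l q r (canonical_moments 0 0) k"
    using assms unfolding isotropic_moments_def by blast
  have "hankel_det m = hankel_det (affine_moments l q r (canonical_moments 0 0))"
    by (rule hankel_det_cong) (use eq in auto)
  also have "\<dots> = l ^ 3 * q ^ 6 * (1/8)" by (simp add: hankel_det_affine hankel_det_canonical)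
  also have "\<dots> > 0" using lq by (intro mult_pos_pos) auto
  finally show ?thesis .
qed

section \<open>Equally spaced points and their affine images\<close>

abbreviation base_angle :: "real \<Rightarrow> nat \<Rightarrow> real" where
  "base_angle \<theta> i \<equiv> pi * (base_point i - \<theta>)"

lemma base_angle_cos_sin:
  fixes \<theta> :: real
  defines "c \<equiv> cos (pi * \<theta>)" and "s \<equiv> sin (pi * \<theta>)"
  shows "cos (base_angle \<theta> 1) = c / 2 - sqrt 3 / 2 * s" "sin (base_angle \<theta> 1) = - (sqrt 3 / 2 * c) - s / 2"
    and "cos (base_angle \<theta> 2) = c" "sin (base_angle \<theta> 2) = - s"
    and "cos (base_angle \<theta> 3) = c / 2 + sqrt 3 / 2 * s" "sin (base_angle \<theta> 3) = sqrt 3 / 2 * c - s / 2"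
proof -
  have "base_angle \<theta> 1 = - (pi / 3) - pi * \<theta>" "base_angle \<theta> 2 = - (pi * \<theta>)"
    "base_angle \<theta> 3 = pi / 3 - pi * \<theta>"
    by (simp_all add: base_point_def algebra_simps)
  then show "cos (base_angle \<theta> 1) = c / 2 - sqrt 3 / 2 * s" "sin (base_angle \<theta> 1) = - (sqrt 3 / 2 * c) - s / 2"
    "cos (base_angle \<theta> 2) = c" "sin (base_angle \<theta> 2) = - s"
    "cos (base_angle \<theta> 3) = c / 2 + sqrt 3 / 2 * s" "sin (base_angle \<theta> 3) = sqrt 3 / 2 * c - s / 2"
    unfolding c_def s_def by (simp_all only: cos_diff sin_diff cos_minus sin_minus cos_60 sin_60)
qed

text \<open>The doubled angles are spaced by a third of a full turn, so the sums of the first and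
  second trigonometric moments vanish for every \<open>\<theta>\<close>. The proof expands this
  directly.\<close>

lemma sum_base_moments:
  fixes \<theta> :: real
  defines "b \<equiv> \<lambda>k. \<Sum>i\<in>{1,2,3}. cos (base_angle \<theta> i) ^ (4 - k) * sin (base_angle \<theta> i) ^ k"
  shows "\<forall>k\<le>4. b k = 3/2 * canonical_moments 0 0 k"
proof -
  define c s where "c = cos (pi * \<theta>)" and "s = sin (pi * \<theta>)"
  \<comment> \<open>The expansions treat \<open>w\<close> as an indeterminate;
    \<open>w^2 = 3/4\<close> is substituted only afterwards.\<close>
  define w where "w = sqrt 3 / (2 :: real)"
  have w: "w\<^sup>2 = 3/4" by (simp add: w_def power_divide)
  have cs: "c\<^sup>2 + s\<^sup>2 = 1" by (simp add: c_def s_def)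
  have b: "b k = (c / 2 - w * s) ^ (4 - k) * (- (w * c) - s / 2) ^ k + c ^ (4 - k) * (- s) ^ k
       + (c / 2 + w * s) ^ (4 - k) * (w * c - s / 2) ^ k" for k
  proof -
    have "b k = cos (base_angle \<theta> 1) ^ (4 - k) * sin (base_angle \<theta> 1) ^ k
      + cos (base_angle \<theta> 2) ^ (4 - k) * sin (base_angle \<theta> 2) ^ k
      + cos (base_angle \<theta> 3) ^ (4 - k) * sin (base_angle \<theta> 3) ^ k"
      by (simp add: b_def)
    then show ?thesis
      unfolding base_angle_cos_sin c_def[symmetric] s_def[symmetric] w_def[symmetric] .
  qed
  have b0: "b 0 = (c / 2 - w * s) ^ 4 + c ^ 4 + (c / 2 + w * s) ^ 4"
    and b1: "b 1 = (c / 2 - w * s) ^ 3 * (- (w * c) - s / 2) - c ^ 3 * s + (c / 2 + w * s) ^ 3 * (w * c - s / 2)"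
    and b2: "b 2 = (c / 2 - w * s)\<^sup>2 * (- (w * c) - s / 2)\<^sup>2 + c\<^sup>2 * s\<^sup>2 + (c / 2 + w * s)\<^sup>2 * (w * c - s / 2)\<^sup>2"
    and b3: "b 3 = (c / 2 - w * s) * (- (w * c) - s / 2) ^ 3 - c * s ^ 3 + (c / 2 + w * s) * (w * c - s / 2) ^ 3"
    and b4: "b 4 = (- (w * c) - s / 2) ^ 4 + s ^ 4 + (w * c - s / 2) ^ 4"
    by (simp_all add: b)
  have "b 0 = c ^ 4 + c ^ 4 / 8 + 3 * c\<^sup>2 * s\<^sup>2 * w\<^sup>2 + 2 * s ^ 4 * (w\<^sup>2)\<^sup>2"
    unfolding b0 by (simp add: eval_nat_numeral field_simps)
  also have "\<dots> = 9/8 * (c\<^sup>2 + s\<^sup>2)\<^sup>2" unfolding w by (simp add: eval_nat_numeral field_simps)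
  finally have "b 0 = 9/8 * (c\<^sup>2 + s\<^sup>2)\<^sup>2" .
  moreover have "b 1 = 0"
  proof -
    have "b 1 = 3/2 * c ^ 3 * s * w\<^sup>2 + 2 * c * s ^ 3 * (w\<^sup>2)\<^sup>2 - c ^ 3 * s / 8 - 3/2 * c * s ^ 3 * w\<^sup>2 - c ^ 3 * s"
      unfolding b1 by (simp add: eval_nat_numeral field_simps)
    then show ?thesis unfolding w by (simp add: eval_nat_numeral field_simps)
  qed
  moreover have "b 2 = 3/8 * (c\<^sup>2 + s\<^sup>2)\<^sup>2"
  proof -
    have "b 2 = w\<^sup>2 * (c\<^sup>2 - s\<^sup>2)\<^sup>2 / 2 + 2 * c\<^sup>2 * s\<^sup>2 * (1/4 - w\<^sup>2)\<^sup>2 + c\<^sup>2 * s\<^sup>2"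
      unfolding b2 by (simp add: eval_nat_numeral field_simps)
    also have "\<dots> = 3/8 * (c\<^sup>2 + s\<^sup>2)\<^sup>2" unfolding w by (simp add: eval_nat_numeral field_simps)
    finally show ?thesis .
  qed
  moreover have "b 3 = 0"
  proof -
    have "b 3 = - (3/2 * c ^ 3 * s * w\<^sup>2) - c * s ^ 3 / 8 + 2 * c ^ 3 * s * (w\<^sup>2)\<^sup>2 + 3/2 * c * s ^ 3 * w\<^sup>2 - c * s ^ 3"
      unfolding b3 by (simp add: eval_nat_numeral field_simps)
    then show ?thesis unfolding w by (simp add: eval_nat_numeral field_simps)
  qed
  moreover have "b 4 = 9/8 * (c\<^sup>2 + s\<^sup>2)\<^sup>2"
  proof -
    have "b 4 = s ^ 4 + 2 * c ^ 4 * (w\<^sup>2)\<^sup>2 + 3 * c\<^sup>2 * s\<^sup>2 * w\<^sup>2 + s ^ 4 / 8"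
      unfolding b4 by (simp add: eval_nat_numeral field_simps)
    also have "\<dots> = 9/8 * (c\<^sup>2 + s\<^sup>2)\<^sup>2" unfolding w by (simp add: eval_nat_numeral field_simps)
    finally show ?thesis .
  qed
  ultimately show ?thesis unfolding all_le_4 cs by simp
qed

lemma sum_affine_moments:
  fixes a c s :: "'i \<Rightarrow> real"
  shows "\<forall>k\<le>4. (\<Sum>i\<in>I. a i * (c i ^ (4 - k) * (q * s i + r * c i) ^ k))
     = affine_moments 1 q r (\<lambda>k. \<Sum>i\<in>I. a i * (c i ^ (4 - k) * s i ^ k)) k"
  unfolding all_le_4 affine_moments_simps sum_distrib_left sum.distrib[symmetric] mult_1
  by (intro conjI sum.cong refl) (simp_all add: eval_nat_numeral algebra_simps)

lemma affine_moments_cong: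
  assumes "\<And>j. j \<le> k \<Longrightarrow> m j = m' j"
  shows "affine_moments l q r m k = affine_moments l q r m' k"
  using assms by (simp add: affine_moments_def)

lemma sin_base_angle_diff:
  assumes "i \<in> {1,2,3}" "j \<in> {1,2,3}" "i \<noteq> j"
  shows "sin (base_angle \<theta> j - base_angle \<theta> i) \<noteq> 0"
proof -
  have e: "base_angle \<theta> j - base_angle \<theta> i = pi * (base_point j - base_point i)" by (simp add: algebra_simps)
  have s: "sin (2 * pi / 3) = sqrt 3 / 2" by (simp add: sin_120)
  have "sin (pi / 3) \<noteq> 0" "sin (- (pi / 3)) \<noteq> 0" "sin (2 * pi / 3) \<noteq> 0" "sin (- (2 * pi / 3)) \<noteq> 0"
    by (simp_all only: sin_minus sin_60 s) simp_all
  then show ?thesis using assms unfolding e by (auto simp: base_point_def mult.commute)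
qed

text \<open>Serves both the Moebius designs and the uniform design. \<open>\<rho> i\<close> is the
  signed length of the image of the \<open>i\<close>-th base direction; it enters the weight with
  exponent 4 because the moments have degree 4 in \<open>(cos, sin)\<close>.\<close>

lemma three_point_design:
  fixes t p \<rho> :: "nat \<Rightarrow> real"
  assumes q: "q \<noteq> 0" and K: "K > 0"
    and t: "\<And>i. i \<in> {1,2,3} \<Longrightarrow> - 1/2 < t i \<and> t i \<le> 1/2"
    and \<rho>: "\<And>i. i \<in> {1,2,3} \<Longrightarrow> \<rho> i \<noteq> 0"
    and cos: "\<And>i. i \<in> {1,2,3} \<Longrightarrow> cos (base_angle \<theta> i) = \<rho> i * cos (pi * t i)"
    and sin: "\<And>i. i \<in> {1,2,3} \<Longrightarrow> q * sin (base_angle \<theta> i) + r * cos (base_angle \<theta> i) = \<rho> i * sin (pi * t i)"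
    and p: "\<And>i. i \<in> {1,2,3} \<Longrightarrow> p i = K * \<rho> i ^ 4"
    and sum: "(\<Sum>i\<in>{1,2,3}. p i) = 1"
  defines "\<xi> \<equiv> (\<lambda>i. (t i, p i)) ` {1,2,3}"
  shows "is_design \<xi>" and "card \<xi> = 3"
    and "\<forall>k\<le>4. design_moments \<xi> k = affine_moments (3/2 * K) q r (canonical_moments 0 0) k"
proof -
  have inj: "inj_on t {1,2,3}"
  proof (rule inj_onI, rule ccontr)
    fix i j assume ij: "i \<in> {1,2,3}" "j \<in> {1,2,3}" "t i = t j" "i \<noteq> j"
    \<comment> \<open>Coinciding points would make two image vectors parallel; their determinant is
      \<open>q\<close> times that of the base directions.\<close>
    have "q * sin (base_angle \<theta> j - base_angle \<theta> i)
      = cos (base_angle \<theta> i) * (q * sin (base_angle \<theta> j) + r * cos (base_angle \<theta> j))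
        - cos (base_angle \<theta> j) * (q * sin (base_angle \<theta> i) + r * cos (base_angle \<theta> i))"
      unfolding sin_diff by (simp add: algebra_simps)
    also have "\<dots> = 0" unfolding sin[OF ij(1)] sin[OF ij(2)] unfolding cos[OF ij(1)] cos[OF ij(2)] ij(3) by simp
    finally show False using q sin_base_angle_diff[OF ij(1,2,4)] by simp
  qed
  then have inj': "inj_on (\<lambda>i. (t i, p i)) {1,2,3}" by (auto simp: inj_on_def)
  then show "card \<xi> = 3" unfolding \<xi>_def by (subst card_image) auto
  have sum_\<xi>: "(\<Sum>x\<in>\<xi>. F x) = (\<Sum>i\<in>{1,2,3}. F (t i, p i))" for F :: "real \<times> real \<Rightarrow> real"
    unfolding \<xi>_def by (subst sum.reindex[OF inj']) simp
  have "inj_on fst \<xi>" using inj unfolding \<xi>_def inj_on_def by auto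
  moreover have "p i > 0" if "i \<in> {1,2,3}" for i using p[OF that] \<rho>[OF that] K by simp
  ultimately show "is_design \<xi>"
    using t sum unfolding is_design_def sum_\<xi> by (auto simp: \<xi>_def)
  have "design_moments \<xi> k = affine_moments (3/2 * K) q r (canonical_moments 0 0) k" if k: "k \<le> 4" for k
  proof -
    have "design_moments \<xi> k = (\<Sum>i\<in>{1,2,3}. K * (cos (base_angle \<theta> i) ^ (4 - k)
        * (q * sin (base_angle \<theta> i) + r * cos (base_angle \<theta> i)) ^ k))"
      unfolding design_moments_def sum_\<xi> prod.case
    proof (rule sum.cong[OF refl])
      fix i :: nat assume i: "i \<in> {1,2,3}"
      have "\<rho> i ^ 4 = \<rho> i ^ (4 - k) * \<rho> i ^ k" using k by (simp add: power_add[symmetric])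
      then show "p i * cos (pi * t i) ^ (4 - k) * sin (pi * t i) ^ k
        = K * (cos (base_angle \<theta> i) ^ (4 - k) * (q * sin (base_angle \<theta> i) + r * cos (base_angle \<theta> i)) ^ k)"
        unfolding sin[OF i] unfolding cos[OF i] p[OF i] by (simp add: power_mult_distrib)
    qed
    also have "\<dots> = affine_moments 1 q r
        (\<lambda>k. \<Sum>i\<in>{1,2,3}. K * (cos (base_angle \<theta> i) ^ (4 - k) * sin (base_angle \<theta> i) ^ k)) k"
      using sum_affine_moments[where I = "{1,2,3}" and a = "\<lambda>_. K" and q = q and r = r
        and c = "\<lambda>i. cos (base_angle \<theta> i)" and s = "\<lambda>i. sin (base_angle \<theta> i)"] k by blast
    also have "\<dots> = affine_moments 1 q r (\<lambda>k. 3/2 * K * canonical_moments 0 0 k) k"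
    proof (rule affine_moments_cong)
      fix j assume "j \<le> k"
      then have j: "j \<le> 4" using k by simp
      have "(\<Sum>i\<in>{1,2,3}. K * (cos (base_angle \<theta> i) ^ (4 - j) * sin (base_angle \<theta> i) ^ j))
          = K * (\<Sum>i\<in>{1,2,3}. cos (base_angle \<theta> i) ^ (4 - j) * sin (base_angle \<theta> i) ^ j)"
        by (rule sum_distrib_left[symmetric])
      also have "(\<Sum>i\<in>{1,2,3}. cos (base_angle \<theta> i) ^ (4 - j) * sin (base_angle \<theta> i) ^ j)
          = 3/2 * canonical_moments 0 0 j"
        using sum_base_moments[of \<theta>] j by blast
      finally show "(\<Sum>i\<in>{1,2,3}. K * (cos (base_angle \<theta> i) ^ (4 - j) * sin (base_angle \<theta> i) ^ j))
          = 3/2 * K * canonical_moments 0 0 j" by simp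
    qed
    also have "\<dots> = affine_moments (3/2 * K) q r (canonical_moments 0 0) k"
      unfolding affine_moments_def by (simp add: sum_distrib_left mult_ac)
    finally show ?thesis .
  qed
  then show "\<forall>k\<le>4. design_moments \<xi> k = affine_moments (3/2 * K) q r (canonical_moments 0 0) k" by blast
qed

section \<open>Moebius designs and uniform designs as instances\<close>

text \<open>Polar form of the image of a base direction, uniform over the regular case and the pole.
  The raw weight is the fourth power of the signed length in both cases.\<close>

lemma mobius_point_polar:
  fixes q r \<theta> :: real and i :: nat
  assumes q: "q \<noteq> 0"
  defines "u \<equiv> base_angle \<theta> i" and "t \<equiv> mobius_point q r \<theta> i"
  shows "- 1/2 < t \<and> t \<le> 1/2"
    and "\<exists>\<rho>. \<rho> \<noteq> 0 \<and> cos u = \<rho> * cos (pi * t) \<and> q * sin u + r * cos u = \<rho> * sin (pi * t)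
           \<and> mobius_raw_weight q r \<theta> i = \<rho> ^ 4"
proof -
  have "- 1/2 < t \<and> t \<le> 1/2 \<and> (\<exists>\<rho>. \<rho> \<noteq> 0 \<and> cos u = \<rho> * cos (pi * t) \<and> q * sin u + r * cos u = \<rho> * sin (pi * t)
           \<and> mobius_raw_weight q r \<theta> i = \<rho> ^ 4)"
  proof (cases "cos u = 0")
    case True
    then have t: "t = 1/2" by (simp add: t_def u_def mobius_point_def)
    have "(sin u)\<^sup>2 = 1" using sin_cos_squared_add[of u] True by simp
    \<comment> \<open>At the pole the image vector is \<open>(0, q * sin u)\<close> with
      \<open>sin u\<close> equal to 1 or -1, so the length \<open>q * sin u\<close> yields the limit
      weight \<open>q ^ 4\<close>.\<close>
    then have "sin u ^ 4 = 1" "sin u \<noteq> 0" by (auto simp: power2_eq_1_iff)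
    moreover have "mobius_raw_weight q r \<theta> i = q ^ 4" using True by (simp add: mobius_raw_weight_def u_def)
    ultimately show ?thesis using q True unfolding t
      by (intro conjI exI[of _ "q * sin u"]) (auto simp: power_mult_distrib)
  next
    case False
    define X where "X = q * tan u + r"
    have t: "pi * t = arctan X" using False by (simp add: t_def u_def mobius_point_def X_def)
    have "pi * (- 1/2) < pi * t" "pi * t < pi * (1/2)" unfolding t using arctan_bounded[of X] by auto
    then have "- 1/2 < t \<and> t < 1/2" by (simp only: mult_less_cancel_left_pos[OF pi_gt_zero])
    moreover have pos: "1 + X\<^sup>2 > 0" by (simp add: add_pos_nonneg)
    have "sqrt (1 + X\<^sup>2) ^ 4 = (1 + X\<^sup>2)\<^sup>2"
      by (simp add: power4_eq_xxxx power2_eq_square)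
    moreover have "mobius_raw_weight q r \<theta> i = ((1 + X\<^sup>2) * (cos u)\<^sup>2)\<^sup>2"
    proof -
      have "1 / (1 + (tan u)\<^sup>2) = (cos u)\<^sup>2"
        using False tan_sec[OF False] by (simp add: power_inverse divide_inverse)
      then show ?thesis using False unfolding mobius_raw_weight_def u_def[symmetric] X_def[symmetric]
        by (simp add: divide_inverse)
    qed
    moreover have "q * sin u + r * cos u = X * cos u" using False by (simp add: X_def tan_def field_simps)
    \<comment> \<open>The witness is the signed length of the vector
      \<open>(cos u, X * cos u)\<close>.\<close>
    ultimately show ?thesis using False pos unfolding t cos_arctan sin_arctan
      by (intro conjI exI[of _ "cos u * sqrt (1 + X\<^sup>2)"]) (auto simp: power_mult_distrib)
  qed
  then show "- 1/2 < t \<and> t \<le> 1/2"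
    and "\<exists>\<rho>. \<rho> \<noteq> 0 \<and> cos u = \<rho> * cos (pi * t) \<and> q * sin u + r * cos u = \<rho> * sin (pi * t)
           \<and> mobius_raw_weight q r \<theta> i = \<rho> ^ 4" by blast+
qed

lemma mobius_raw_weight_pos: "q \<noteq> 0 \<Longrightarrow> mobius_raw_weight q r \<theta> i > 0"
  using mobius_point_polar(2)[where q = q and r = r and \<theta> = \<theta> and i = i] by fastforce

lemma mobius_design_isotropic:
  assumes q: "q \<noteq> 0"
  shows "is_design (mobius_design q r \<theta>)" and "card (mobius_design q r \<theta>) = 3"
    and "isotropic_moments (design_moments (mobius_design q r \<theta>))"
proof -
  define K where "K = 1 / (\<Sum>j\<in>{1,2,3}. mobius_raw_weight q r \<theta> j)"
  have pos: "(\<Sum>j\<in>{1,2,3}. mobius_raw_weight q r \<theta> j) > 0"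
    by (rule sum_pos) (auto intro: mobius_raw_weight_pos[OF q])
  then have K: "K > 0" by (simp add: K_def)
  have "\<exists>\<rho>. \<forall>i. \<rho> i \<noteq> 0 \<and> cos (base_angle \<theta> i) = \<rho> i * cos (pi * mobius_point q r \<theta> i)
      \<and> q * sin (base_angle \<theta> i) + r * cos (base_angle \<theta> i) = \<rho> i * sin (pi * mobius_point q r \<theta> i)
      \<and> mobius_raw_weight q r \<theta> i = \<rho> i ^ 4"
    by (rule choice, rule allI, rule mobius_point_polar(2)[OF q])
  then obtain \<rho> where \<rho>: "\<And>i. \<rho> i \<noteq> 0"
    "\<And>i. cos (base_angle \<theta> i) = \<rho> i * cos (pi * mobius_point q r \<theta> i)"
    "\<And>i. q * sin (base_angle \<theta> i) + r * cos (base_angle \<theta> i) = \<rho> i * sin (pi * mobius_point q r \<theta> i)"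
    "\<And>i. mobius_raw_weight q r \<theta> i = \<rho> i ^ 4"
    by blast
  have w: "mobius_weight q r \<theta> i = K * \<rho> i ^ 4" for i
    by (simp add: mobius_weight_def K_def \<rho>(4))
  have sum: "(\<Sum>i\<in>{1,2,3}. mobius_weight q r \<theta> i) = 1"
    unfolding w \<rho>(4)[symmetric] sum_distrib_left[symmetric] using pos by (simp add: K_def)
  note D = three_point_design[OF q K mobius_point_polar(1)[OF q] \<rho>(1-3) w sum]
  show "is_design (mobius_design q r \<theta>)" "card (mobius_design q r \<theta>) = 3"
    unfolding mobius_design_def using D(1,2) by blast+
  show "isotropic_moments (design_moments (mobius_design q r \<theta>))"
    unfolding mobius_design_def using D(3) K q by (intro isotropic_momentsI[of q "3/2 * K"]) auto
qed

text \<open>Shifting a point by an integer shifts its angle \<open>pi * x\<close> by a multiple of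
  \<open>pi\<close>, which costs only a common sign.\<close>

lemma reduce_mod1_polar:
  "- 1/2 < reduce_mod1 x \<and> reduce_mod1 x \<le> 1/2"
  "\<exists>\<epsilon>. \<epsilon>\<^sup>2 = 1 \<and> cos (pi * x) = \<epsilon> * cos (pi * reduce_mod1 x) \<and> sin (pi * x) = \<epsilon> * sin (pi * reduce_mod1 x)"
proof -
  define n where "n = \<lceil>x - 1/2\<rceil>"
  show "- 1/2 < reduce_mod1 x \<and> reduce_mod1 x \<le> 1/2"
    unfolding reduce_mod1_def by linarith
  have e: "pi * x = pi * reduce_mod1 x + pi * of_int n" by (simp add: reduce_mod1_def n_def algebra_simps)
  have s: "sin (pi * of_int n) = 0" by (simp add: sin_int_times_real mult.commute) 
  then have "(cos (pi * of_int n))\<^sup>2 = 1" using sin_cos_squared_add[of "pi * of_int n"] by simp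
  then show "\<exists>\<epsilon>. \<epsilon>\<^sup>2 = 1 \<and> cos (pi * x) = \<epsilon> * cos (pi * reduce_mod1 x) \<and> sin (pi * x) = \<epsilon> * sin (pi * reduce_mod1 x)"
    unfolding e cos_add sin_add s by (intro exI[of _ "cos (pi * of_int n)"]) simp
qed

lemma uniform_design_moments:
  shows "is_design (uniform_design \<theta>)"
    and "\<forall>k\<le>4. design_moments (uniform_design \<theta>) k = 1/2 * canonical_moments 0 0 k"
proof -
  have "\<exists>\<epsilon>. \<forall>i. (\<epsilon> i)\<^sup>2 = 1 \<and> cos (base_angle \<theta> i) = \<epsilon> i * cos (pi * reduce_mod1 (base_point i - \<theta>))
      \<and> sin (base_angle \<theta> i) = \<epsilon> i * sin (pi * reduce_mod1 (base_point i - \<theta>))"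
    by (rule choice, rule allI, rule reduce_mod1_polar(2))
  then obtain \<epsilon> where \<epsilon>: "\<And>i. (\<epsilon> i)\<^sup>2 = (1 :: real)"
    "\<And>i. cos (base_angle \<theta> i) = \<epsilon> i * cos (pi * reduce_mod1 (base_point i - \<theta>))"
    "\<And>i. sin (base_angle \<theta> i) = \<epsilon> i * sin (pi * reduce_mod1 (base_point i - \<theta>))"
    by blast
  have p: "1/3 = 1/3 * \<epsilon> i ^ 4" for i
  proof -
    have "\<epsilon> i ^ 4 = ((\<epsilon> i)\<^sup>2)\<^sup>2" by algebra
    then show ?thesis by (simp add: \<epsilon>(1))
  qed
  have nz: "\<epsilon> i \<noteq> 0" for i using \<epsilon>(1)[of i] by auto
  have s: "1 * sin (base_angle \<theta> i) + 0 * cos (base_angle \<theta> i) = \<epsilon> i * sin (pi * reduce_mod1 (base_point i - \<theta>))" for i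
    using \<epsilon>(3) by simp
  have sum: "(\<Sum>i\<in>{1,2,3::nat}. 1/3) = (1::real)" by simp
  \<comment> \<open>The affine map is the identity here, with the signs \<open>\<epsilon>\<close> as
    lengths and \<open>K = 1/3\<close>.\<close>
  note D = three_point_design[OF one_neq_zero _ reduce_mod1_polar(1) nz \<epsilon>(2) s p sum, simplified]
  show "is_design (uniform_design \<theta>)" unfolding uniform_design_def using D(1) by simp
  show "\<forall>k\<le>4. design_moments (uniform_design \<theta>) k = 1/2 * canonical_moments 0 0 k"
    using D(3) unfolding uniform_design_def all_le_4 affine_moments_simps by simp
qed

section \<open>Optimality\<close>

lemma isotropic_invertible:
  assumes "isotropic_moments (design_moments \<xi>)"
  shows "invertible (information_matrix \<xi>)"
  using hankel_det_isotropic[OF assms] by (intro invertible_information_matrix) simp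

lemma isotropic_uniform_design: "isotropic_moments (design_moments (uniform_design \<theta>))"
proof -
  have "\<forall>k\<le>4. design_moments (uniform_design \<theta>) k = affine_moments (1/2) 1 0 (canonical_moments 0 0) k"
    using uniform_design_moments(2) unfolding all_le_4 affine_moments_simps by simp
  then show ?thesis by (rule isotropic_momentsI[rotated 2]) auto
qed

text \<open>Isotropic designs all have the volume \<open>L\<close>, the others exceed it, and the
  uniform design shows that \<open>L\<close> is attained. The number of design points is
  arbitrary.\<close>

lemma tube_volume_optimal_iff:
  assumes \<xi>: "is_design \<xi>"
  shows "tube_volume_optimal \<xi> \<longleftrightarrow> isotropic_moments (design_moments \<xi>)"
proof -
  define L :: real where "L = 2 * (2 * pi * sqrt 6 / 3)"
  have iso: "fourier_Vol (matrix_inv (information_matrix \<eta>)) = L"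
    if "is_design \<eta>" "isotropic_moments (design_moments \<eta>)" for \<eta>
    using tube_length_isotropic[OF positive_design_moments[OF that(1) isotropic_invertible[OF that(2)]] that(2)]
      fourier_Vol_eq[OF that(1) isotropic_invertible[OF that(2)]] by (simp add: L_def)
  have non: "L < fourier_Vol (matrix_inv (information_matrix \<eta>))"
    if "is_design \<eta>" "invertible (information_matrix \<eta>)" "\<not> isotropic_moments (design_moments \<eta>)" for \<eta>
    using tube_length_non_isotropic[OF positive_design_moments[OF that(1,2)] that(3)]
      fourier_Vol_eq[OF that(1,2)] by (simp add: L_def)
  show ?thesis
  proof
    assume opt: "tube_volume_optimal \<xi>"
    show "isotropic_moments (design_moments \<xi>)"
    proof (rule ccontr)
      assume "\<not> isotropic_moments (design_moments \<xi>)"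
      then have "L < fourier_Vol (matrix_inv (information_matrix \<xi>))"
        using opt non[OF \<xi>] unfolding tube_volume_optimal_def by blast
      moreover have "fourier_Vol (matrix_inv (information_matrix \<xi>))
          \<le> fourier_Vol (matrix_inv (information_matrix (uniform_design 0)))"
        using opt uniform_design_moments(1) isotropic_invertible[OF isotropic_uniform_design]
        unfolding tube_volume_optimal_def by blast
      ultimately show False
        using iso[OF uniform_design_moments(1) isotropic_uniform_design] by simp
    qed
  next
    assume i: "isotropic_moments (design_moments \<xi>)"
    have "L \<le> fourier_Vol (matrix_inv (information_matrix \<eta>))"
      if "is_design \<eta>" "invertible (information_matrix \<eta>)" for \<eta>
      using iso[of \<eta>] non[of \<eta>] that by (cases "isotropic_moments (design_moments \<eta>)") auto
    then show "tube_volume_optimal \<xi>"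
      unfolding tube_volume_optimal_def using \<xi> isotropic_invertible[OF i] iso[OF \<xi> i] by simp
  qed
qed

section \<open>D-optimality of the uniform design\<close>

text \<open>The first diagonal entry is 1 and the other two add up to 2. The determinant is at most
  the product of the diagonal, and that product is at most 1.\<close>

lemma det_information_matrix_le_1:
  assumes \<xi>: "is_design \<xi>"
  shows "det (information_matrix \<xi>) \<le> 1"
proof -
  let ?M = "information_matrix \<xi>"
  define N where "N i j = (\<Sum>(t, p)\<in>\<xi>. p * (fourier_f t $ i * fourier_f t $ j))" for i j
  have N: "?M $ i $ j = N i j" for i j by (simp add: N_def information_matrix_component)
  have sym: "N i j = N j i" for i j by (simp add: N_def mult_ac)
  have pos: "\<And>t p. (t, p) \<in> \<xi> \<Longrightarrow> p > 0" and sum: "(\<Sum>(t, p)\<in>\<xi>. p) = 1"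
    using \<xi> unfolding is_design_def by auto
  have CS: "(N i j)\<^sup>2 \<le> N i i * N j j" for i j
  proof -
    \<comment> \<open>Splitting each weight into two square roots turns the entries into plain inner
      products, ready for Cauchy-Schwarz.\<close>
    have e: "N i j = (\<Sum>(t, p)\<in>\<xi>. (sqrt p * fourier_f t $ i) * (sqrt p * fourier_f t $ j))" for i j
      unfolding N_def
    proof (rule sum.cong[OF refl], clarify)
      fix t p assume "(t, p) \<in> \<xi>"
      then have "sqrt p * sqrt p = p" using pos[of t p] by simp
      then have "p * (fourier_f t $ i * fourier_f t $ j) = (sqrt p * sqrt p) * (fourier_f t $ i * fourier_f t $ j)"
        by simp
      then show "p * (fourier_f t $ i * fourier_f t $ j) = sqrt p * fourier_f t $ i * (sqrt p * fourier_f t $ j)"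
        by (simp only: mult_ac)
    qed
    show ?thesis unfolding e case_prod_unfold
      using Cauchy_Schwarz_ineq_sum[of "\<lambda>x. sqrt (snd x) * fourier_f (fst x) $ i"
          "\<lambda>x. sqrt (snd x) * fourier_f (fst x) $ j" \<xi>] by (simp add: power2_eq_square)
  qed
  have N11: "N 1 1 = 1" using sum by (simp add: N_def fourier_f_def)
  have "N 2 2 + N 3 3 = (\<Sum>(t, p)\<in>\<xi>. p * 2)"
  proof -
    have "fourier_f t $ 2 * fourier_f t $ 2 + fourier_f t $ 3 * fourier_f t $ 3 = 2" for t
    proof -
      have "fourier_f t $ 2 * fourier_f t $ 2 + fourier_f t $ 3 * fourier_f t $ 3
        = (sqrt 2 * sqrt 2) * ((sin (2 * pi * t))\<^sup>2 + (cos (2 * pi * t))\<^sup>2)"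
        unfolding fourier_f_def by (simp only: vector_3) algebra
      then show ?thesis by simp
    qed
    then show ?thesis unfolding N_def sum.distrib[symmetric] case_prod_unfold distrib_left[symmetric] by simp
  qed
  also have "\<dots> = 2" using sum by (simp add: sum_distrib_right[symmetric] case_prod_unfold)
  finally have tr: "N 2 2 + N 3 3 = 2" .
  have nn: "N i i \<ge> 0" for i unfolding N_def by (rule sum_nonneg) (auto dest: pos intro: less_imp_le)
  define b c x y z where "b = N 2 2" and "c = N 3 3" and "x = N 1 2" and "y = N 1 3" and "z = N 2 3"
  have bc: "b + c = 2" "b \<ge> 0" "c \<ge> 0" using tr nn by (auto simp: b_def c_def)
  have ineq: "x\<^sup>2 \<le> b" "y\<^sup>2 \<le> c" "z\<^sup>2 \<le> b * c"
    using CS[of 1 2] CS[of 1 3] CS[of 2 3] by (simp_all add: N11 b_def c_def x_def y_def z_def)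
  have "det ?M = b * c + 2 * x * y * z - z\<^sup>2 - b * y\<^sup>2 - c * x\<^sup>2"
    unfolding det_3 N sym[of 2 1] sym[of 3 1] sym[of 3 2] N11 b_def c_def x_def y_def z_def
    by (simp add: power2_eq_square algebra_simps)
  also have "\<dots> \<le> b * c"
  proof -
    \<comment> \<open>By \<open>z^2 \<le> b * c\<close> the left side is at most
      \<open>4 * b * c * (x * y)^2\<close>, and the arithmetic-geometric mean inequality does the
      rest.\<close>
    have "(2 * \<bar>x * y * z\<bar>)\<^sup>2 \<le> (b * y\<^sup>2 + c * x\<^sup>2)\<^sup>2"
    proof -
      have "(x * y)\<^sup>2 * z\<^sup>2 \<le> (x * y)\<^sup>2 * (b * c)" using ineq(3) by (intro mult_left_mono) auto
      moreover have "0 \<le> (b * y\<^sup>2 - c * x\<^sup>2)\<^sup>2" by simp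
      moreover have "(b * y\<^sup>2 - c * x\<^sup>2)\<^sup>2 = (b * y\<^sup>2 + c * x\<^sup>2)\<^sup>2 - 4 * ((x * y)\<^sup>2 * (b * c))" by algebra
      moreover have "(2 * \<bar>x * y * z\<bar>)\<^sup>2 = 4 * ((x * y)\<^sup>2 * z\<^sup>2)" by (simp add: power_mult_distrib)
      ultimately show ?thesis by linarith
    qed
    then have "2 * \<bar>x * y * z\<bar> \<le> b * y\<^sup>2 + c * x\<^sup>2"
      by (rule power2_le_imp_le) (use bc in simp)
    moreover have "2 * x * y * z = 2 * (x * y * z)" by simp
    ultimately show ?thesis using zero_le_power2[of z] abs_ge_self[of "x * y * z"] by linarith
  qed
  also have "\<dots> \<le> 1"
  proof -
    have c: "c = 2 - b" using bc(1) by simp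
    have "1 - b * c = (1 - b)\<^sup>2" unfolding c by algebra
    then show ?thesis using zero_le_power2[of "1 - b"] by linarith
  qed
  finally show ?thesis .
qed

lemma det_uniform_design: "det (information_matrix (uniform_design \<theta>)) = 1"
proof -
  have m: "design_moments (uniform_design \<theta>) 0 = 3/8" "design_moments (uniform_design \<theta>) 1 = 0"
    "design_moments (uniform_design \<theta>) 2 = 1/8" "design_moments (uniform_design \<theta>) 3 = 0"
    "design_moments (uniform_design \<theta>) 4 = 3/8"
    using uniform_design_moments(2)[of \<theta>] unfolding all_le_4 by simp_all
  show ?thesis
    unfolding information_matrix_eq det_mul det_transpose
    by (simp add: det_3 basis_change_def hankel_matrix_def m m[unfolded One_nat_def])
qed

lemma D_optimal_uniform_design: "D_optimal (uniform_design \<theta>)"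
  unfolding D_optimal_def det_uniform_design
  using uniform_design_moments(1) det_information_matrix_le_1 by blast

section \<open>Every three-point isotropic design is a Moebius design\<close>

text \<open>The weighted regression vectors at the three points form a square matrix with
  orthonormal rows, hence with orthonormal columns. The norms of the columns give the weights, and
  their inner products give the angles.\<close>

lemma orthogonal_points:
  fixes u P :: "nat \<Rightarrow> real"
  assumes l: "l > 0" and P: "\<And>i. i \<in> {1,2,3} \<Longrightarrow> P i > 0"
    and mom: "\<forall>k\<le>4. (\<Sum>i\<in>{1,2,3}. P i * (cos (u i) ^ (4 - k) * sin (u i) ^ k)) = l * canonical_moments 0 0 k"
  shows "\<And>i. i \<in> {1,2,3} \<Longrightarrow> P i = 2 * l / 3"
    and "\<And>i j. i \<in> {1,2,3} \<Longrightarrow> j \<in> {1,2,3} \<Longrightarrow> i \<noteq> j \<Longrightarrow> cos (2 * (u i - u j)) = - 1/2"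
proof -
  obtain w :: real where r2: "w\<^sup>2 = 2" using real_sqrt_pow2[of 2] by fastforce
  \<comment> \<open>The total mass is \<open>2 * l\<close>, so dividing by it makes the rows of
    \<open>A\<close> unit vectors.\<close>
  define e where "e i = sqrt (P i / (2 * l))" for i
  define c s where "c i = cos (u i)" and "s i = sin (u i)" for i
  define v1 v2 where "v1 i = w * (2 * (c i * s i))" and "v2 i = w * ((c i)\<^sup>2 - (s i)\<^sup>2)" for i
  have e2: "(e i)\<^sup>2 = P i / (2 * l)" "e i > 0" if "i \<in> {1,2,3}" for i
    using P[OF that] l by (simp_all add: e_def)
  have cs: "(c i)\<^sup>2 + (s i)\<^sup>2 = 1" for i by (simp add: c_def s_def)
  define A :: "real ^ 3 ^ 3" where "A = vector [vector [e 1, e 2, e 3],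
     vector [e 1 * v1 1, e 2 * v1 2, e 3 * v1 3], vector [e 1 * v2 1, e 2 * v2 2, e 3 * v2 3]]"
  define b where "b k = (\<Sum>i\<in>{1,2,3}. P i * (c i ^ (4 - k) * s i ^ k))" for k
  have b: "b 0 = l * (3/4)" "b 1 = 0" "b 2 = l * (1/4)" "b 3 = 0" "b 4 = l * (3/4)"
    using mom unfolding all_le_4 b_def c_def s_def by simp_all
  have sumE: "(e 1)\<^sup>2 * F 1 + (e 2)\<^sup>2 * F 2 + (e 3)\<^sup>2 * F 3 = (\<Sum>i\<in>{1,2,3}. P i * F i) / (2 * l)" for F :: "nat \<Rightarrow> real"
    using l by (simp add: e2 add_divide_distrib)
  have M00: "(\<Sum>i\<in>{1,2,3}. P i * 1) = b 0 + 2 * b 2 + b 4"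
  proof -
    have "(1::real) = c i ^ 4 + 2 * (c i)\<^sup>2 * (s i)\<^sup>2 + s i ^ 4" for i using cs[of i] by algebra
    then have "(\<Sum>i\<in>{1,2,3}. P i * 1) = (\<Sum>i\<in>{1,2,3}. P i * (c i ^ 4 + 2 * (c i)\<^sup>2 * (s i)\<^sup>2 + s i ^ 4))" by metis
    then show ?thesis unfolding b_def by (simp add: algebra_simps)
  qed
  have M01: "(\<Sum>i\<in>{1,2,3}. P i * v1 i) = w * 2 * (b 1 + b 3)"
  proof -
    have "v1 i = w * 2 * (c i ^ 3 * s i + c i * s i ^ 3)" for i using cs[of i] unfolding v1_def by algebra
    then have "(\<Sum>i\<in>{1,2,3}. P i * v1 i) = (\<Sum>i\<in>{1,2,3}. P i * (w * 2 * (c i ^ 3 * s i + c i * s i ^ 3)))" by simp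
    then show ?thesis unfolding b_def by (simp add: algebra_simps)
  qed
  have M02: "(\<Sum>i\<in>{1,2,3}. P i * v2 i) = w * (b 0 - b 4)"
  proof -
    have "v2 i = w * (c i ^ 4 - s i ^ 4)" for i using cs[of i] unfolding v2_def by algebra
    then have "(\<Sum>i\<in>{1,2,3}. P i * v2 i) = (\<Sum>i\<in>{1,2,3}. P i * (w * (c i ^ 4 - s i ^ 4)))" by simp
    then show ?thesis unfolding b_def by (simp add: algebra_simps)
  qed
  have M11: "(\<Sum>i\<in>{1,2,3}. P i * (v1 i * v1 i)) = 8 * b 2"
  proof -
    have "v1 i * v1 i = 8 * ((c i)\<^sup>2 * (s i)\<^sup>2)" for i
    proof -
      have "v1 i * v1 i = w\<^sup>2 * (4 * ((c i)\<^sup>2 * (s i)\<^sup>2))" unfolding v1_def by algebra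
      then show ?thesis unfolding r2 by simp
    qed
    then show ?thesis unfolding b_def by (simp add: algebra_simps)
  qed
  have M12: "(\<Sum>i\<in>{1,2,3}. P i * (v1 i * v2 i)) = 4 * (b 1 - b 3)"
  proof -
    have "v1 i * v2 i = 4 * (c i ^ 3 * s i - c i * s i ^ 3)" for i
    proof -
      have "v1 i * v2 i = w\<^sup>2 * (2 * (c i ^ 3 * s i - c i * s i ^ 3))" unfolding v1_def v2_def by algebra
      then show ?thesis unfolding r2 by simp
    qed
    then have "(\<Sum>i\<in>{1,2,3}. P i * (v1 i * v2 i)) = (\<Sum>i\<in>{1,2,3}. P i * (4 * (c i ^ 3 * s i - c i * s i ^ 3)))"
      by (simp only:)
    then show ?thesis unfolding b_def by (simp add: algebra_simps)
  qed
  have M22: "(\<Sum>i\<in>{1,2,3}. P i * (v2 i * v2 i)) = 2 * (b 0 - 2 * b 2 + b 4)"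
  proof -
    have "v2 i * v2 i = 2 * (c i ^ 4 - 2 * (c i)\<^sup>2 * (s i)\<^sup>2 + s i ^ 4)" for i
    proof -
      have "v2 i * v2 i = w\<^sup>2 * (c i ^ 4 - 2 * (c i)\<^sup>2 * (s i)\<^sup>2 + s i ^ 4)" unfolding v2_def by algebra
      then show ?thesis unfolding r2 .
    qed
    then have "(\<Sum>i\<in>{1,2,3}. P i * (v2 i * v2 i))
        = (\<Sum>i\<in>{1,2,3}. P i * (2 * (c i ^ 4 - 2 * (c i)\<^sup>2 * (s i)\<^sup>2 + s i ^ 4)))"
      by (simp only:)
    then show ?thesis unfolding b_def by (simp add: algebra_simps)
  qed
  have "A ** transpose A = mat 1"
  proof -
    have S: "e 1 * e 1 + e 2 * e 2 + e 3 * e 3 = 1"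
      using sumE[of "\<lambda>_. 1"] M00 b l by (simp add: power2_eq_square)
    have S1: "e 1 * (e 1 * v1 1) + e 2 * (e 2 * v1 2) + e 3 * (e 3 * v1 3) = 0"
      using sumE[of v1] M01 b l by (simp add: power2_eq_square mult_ac)
    have S2: "e 1 * (e 1 * v2 1) + e 2 * (e 2 * v2 2) + e 3 * (e 3 * v2 3) = 0"
      using sumE[of v2] M02 b l by (simp add: power2_eq_square mult_ac)
    have S11: "e 1 * v1 1 * (e 1 * v1 1) + e 2 * v1 2 * (e 2 * v1 2) + e 3 * v1 3 * (e 3 * v1 3) = 1"
      using sumE[of "\<lambda>i. v1 i * v1 i"] M11 b l by (simp add: power2_eq_square mult_ac)
    have S12: "e 1 * v1 1 * (e 1 * v2 1) + e 2 * v1 2 * (e 2 * v2 2) + e 3 * v1 3 * (e 3 * v2 3) = 0"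
      using sumE[of "\<lambda>i. v1 i * v2 i"] M12 b l by (simp add: power2_eq_square mult_ac)
    have S22: "e 1 * v2 1 * (e 1 * v2 1) + e 2 * v2 2 * (e 2 * v2 2) + e 3 * v2 3 * (e 3 * v2 3) = 1"
      using sumE[of "\<lambda>i. v2 i * v2 i"] M22 b l by (simp add: power2_eq_square mult_ac)
    show ?thesis
      using S S1 S2 S11 S12 S22
      by (simp add: vec_eq_iff forall_3 matrix_matrix_mult_def sum_3 transpose_def A_def mat_def mult_ac)
  qed
  \<comment> \<open>This is where having exactly three points matters: \<open>A\<close> is
    square.\<close>
  then have AA: "transpose A ** A = mat 1" using matrix_left_right_inverse by blast
  define G where "G i j = 1 + v1 i * v1 j + v2 i * v2 j" for i j
  have G: "G i j = 1 + 2 * cos (2 * (u i - u j))" for i j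
  proof -
    have "2 * (u i - u j) = 2 * u i - 2 * u j" by simp
    then have "cos (2 * (u i - u j)) = ((c i)\<^sup>2 - (s i)\<^sup>2) * ((c j)\<^sup>2 - (s j)\<^sup>2) + (2 * (c i * s i)) * (2 * (c j * s j))"
      by (simp only: cos_diff cos_double sin_double c_def s_def) (simp add: mult_ac)
    moreover have "G i j = 1 + w\<^sup>2 * (((c i)\<^sup>2 - (s i)\<^sup>2) * ((c j)\<^sup>2 - (s j)\<^sup>2) + (2 * (c i * s i)) * (2 * (c j * s j)))"
      unfolding G_def v1_def v2_def by algebra
    ultimately show ?thesis unfolding r2 by simp
  qed
  have Geq: "e i * e j * G i j = (if i = j then 1 else 0)" if "i \<in> {1,2,3}" "j \<in> {1,2,3}" for i j
  proof -
    have "\<forall>i\<in>{1,2,3}. \<forall>j\<in>{1,2,3}. e i * e j * G i j = (if i = j then 1 else 0)"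
      using AA
      by (simp add: vec_eq_iff forall_3 matrix_matrix_mult_def sum_3 transpose_def A_def mat_def G_def algebra_simps)
    then show ?thesis using that by blast
  qed
  show "P i = 2 * l / 3" if i: "i \<in> {1,2,3}" for i
    using Geq[OF i i] e2[OF i] l by (simp add: G power2_eq_square[symmetric] field_simps)
  show "cos (2 * (u i - u j)) = - 1/2" if ij: "i \<in> {1,2,3}" "j \<in> {1,2,3}" "i \<noteq> j" for i j
    using Geq[OF ij(1,2)] e2(2)[OF ij(1)] e2(2)[OF ij(2)] ij(3) by (simp add: G)
qed

lemma representative_unique:
  fixes x y \<kappa> :: real
  assumes x: "- 1/2 < x" "x \<le> 1/2" and y: "- 1/2 < y" "y \<le> 1/2"
    and cos: "cos (pi * x) = \<kappa> * cos (pi * y)" and sin: "sin (pi * x) = \<kappa> * sin (pi * y)"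
  shows "x = y" and "\<kappa> ^ 4 = 1"
proof -
  have "sin (pi * x - pi * y) = 0" unfolding sin_diff cos sin by simp
  moreover have "\<bar>pi * x - pi * y\<bar> < pi"
  proof -
    have "\<bar>x - y\<bar> < 1" using x y by (simp add: abs_less_iff)
    then have "pi * \<bar>x - y\<bar> < pi * 1" by (intro mult_strict_left_mono) auto
    then show ?thesis by (simp add: right_diff_distrib[symmetric] abs_mult)
  qed
  ultimately have "pi * x - pi * y = 0" using sin_zero_pi_iff by blast
  then show "x = y" by simp
  have "1 = \<kappa>\<^sup>2 * ((cos (pi * y))\<^sup>2 + (sin (pi * y))\<^sup>2)"
    using sin_cos_squared_add2[of "pi * x"] unfolding cos sin by (simp only: power_mult_distrib distrib_left)
  then have "\<kappa>\<^sup>2 = 1" by simp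
  then have "(\<kappa>\<^sup>2)\<^sup>2 = 1" by simp
  then show "\<kappa> ^ 4 = 1" by simp
qed

text \<open>The sign conditions on the sines fix the orientation, so that \<open>u 1\<close>,
  \<open>u 2\<close>, \<open>u 3\<close> follow the order of the base points.\<close>

lemma design_eq_mobius_design:
  fixes t p u \<sigma> :: "nat \<Rightarrow> real"
  assumes q: "q \<noteq> 0"
    and t: "\<And>i. i \<in> {1,2,3} \<Longrightarrow> - 1/2 < t i \<and> t i \<le> 1/2"
    and cos: "\<And>i. i \<in> {1,2,3} \<Longrightarrow> cos (pi * t i) = \<sigma> i * cos (u i)"
    and sin: "\<And>i. i \<in> {1,2,3} \<Longrightarrow> sin (pi * t i) = \<sigma> i * (q * sin (u i) + r * cos (u i))"
    and p: "\<And>i. i \<in> {1,2,3} \<Longrightarrow> p i * \<sigma> i ^ 4 = P" and sum: "(\<Sum>i\<in>{1,2,3}. p i) = 1"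
    and \<sigma>: "\<And>i. i \<in> {1,2,3} \<Longrightarrow> \<sigma> i \<noteq> 0"
    and c12: "cos (2 * (u 1 - u 2)) = - 1/2" and s12: "sin (2 * (u 1 - u 2)) = - (sqrt 3 / 2)"
    and c32: "cos (2 * (u 3 - u 2)) = - 1/2" and s32: "sin (2 * (u 3 - u 2)) = sqrt 3 / 2"
  shows "\<exists>\<theta>. (\<lambda>i. (t i, p i)) ` {1,2,3} = mobius_design q r \<theta>"
proof -
  \<comment> \<open>Chosen so that the middle base point 0 has angle \<open>u 2\<close>.\<close>
  define \<theta> where "\<theta> = - u 2 / pi"
  have \<theta>: "pi * (x - \<theta>) = pi * x + u 2" for x by (simp add: \<theta>_def field_simps)
  have ex: "\<exists>\<epsilon>. \<epsilon>\<^sup>2 = 1 \<and> cos (u i) = \<epsilon> * cos (base_angle \<theta> i) \<and> sin (u i) = \<epsilon> * sin (base_angle \<theta> i)"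
    if i: "i \<in> {1,2,3}" for i
  proof -
    have "cos (2 * (u i - u 2)) = cos (2 * (pi * base_point i)) \<and> sin (2 * (u i - u 2)) = sin (2 * (pi * base_point i))"
    proof -
      have e: "2 * (pi * base_point 1) = - (2 * pi / 3)" "2 * (pi * base_point 2) = 0"
        "2 * (pi * base_point 3) = 2 * pi / 3" by (simp_all add: base_point_def)
      have bp: "cos (2 * (pi * base_point 1)) = - 1/2" "sin (2 * (pi * base_point 1)) = - (sqrt 3 / 2)"
        "cos (2 * (pi * base_point 2)) = 1" "sin (2 * (pi * base_point 2)) = 0"
        "cos (2 * (pi * base_point 3)) = - 1/2" "sin (2 * (pi * base_point 3)) = sqrt 3 / 2"
        unfolding e by (simp_all add: cos_120 sin_120)
      have u2: "cos (2 * (u 2 - u 2)) = 1" "sin (2 * (u 2 - u 2)) = 0" by simp_all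
      from i have "i = 1 \<or> i = 2 \<or> i = 3" by blast
      then show ?thesis by (elim disjE) (simp_all only: bp c12 s12 c32 s32 u2)
    qed
    \<comment> \<open>The doubled angles agree modulo a full turn, so \<open>u i\<close> and the
      base angle differ by some \<open>\<delta>\<close> with \<open>sin \<delta> = 0\<close>; the
      sign \<open>\<epsilon>\<close> is \<open>cos \<delta>\<close>.\<close>
    then have "cos (2 * (u i - u 2) - 2 * (pi * base_point i)) = (cos (2 * (pi * base_point i)))\<^sup>2 + (sin (2 * (pi * base_point i)))\<^sup>2"
      unfolding cos_diff by (simp add: power2_eq_square)
    then have "cos (2 * (u i - u 2) - 2 * (pi * base_point i)) = 1" by simp
    moreover define \<delta> where "\<delta> = u i - base_angle \<theta> i"
    have "2 * (u i - u 2) - 2 * (pi * base_point i) = 2 * \<delta>" unfolding \<delta>_def \<theta> by simp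
    ultimately have "cos (2 * \<delta>) = 1" by simp
    then have s: "sin \<delta> = 0" unfolding cos_double_sin by simp
    then have "(cos \<delta>)\<^sup>2 = 1" using sin_cos_squared_add[of \<delta>] by simp
    moreover have "u i = \<delta> + base_angle \<theta> i" by (simp add: \<delta>_def)
    ultimately show ?thesis using s by (intro exI[of _ "cos \<delta>"]) (simp add: cos_add sin_add)
  qed
  have eq: "t i = mobius_point q r \<theta> i \<and> p i = P * mobius_raw_weight q r \<theta> i" if i: "i \<in> {1,2,3}" for i
  proof -
    obtain \<epsilon> where \<epsilon>: "\<epsilon>\<^sup>2 = 1" "cos (u i) = \<epsilon> * cos (base_angle \<theta> i)" "sin (u i) = \<epsilon> * sin (base_angle \<theta> i)"
      using ex[OF i] by blast
    obtain \<rho> where \<rho>: "cos (base_angle \<theta> i) = \<rho> * cos (pi * mobius_point q r \<theta> i)"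
      "q * sin (base_angle \<theta> i) + r * cos (base_angle \<theta> i) = \<rho> * sin (pi * mobius_point q r \<theta> i)"
      "mobius_raw_weight q r \<theta> i = \<rho> ^ 4"
      using mobius_point_polar(2)[OF q, where r = r and \<theta> = \<theta> and i = i] by blast
    have "cos (pi * t i) = \<sigma> i * \<epsilon> * \<rho> * cos (pi * mobius_point q r \<theta> i)"
      unfolding cos[OF i] \<epsilon> \<rho> by simp
    moreover have "sin (pi * t i) = \<sigma> i * \<epsilon> * \<rho> * sin (pi * mobius_point q r \<theta> i)"
    proof -
      have "sin (pi * t i) = \<sigma> i * \<epsilon> * (q * sin (base_angle \<theta> i) + r * cos (base_angle \<theta> i))"
        unfolding sin[OF i] \<epsilon> by (simp add: algebra_simps)
      then show ?thesis unfolding \<rho>(2) by simp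
    qed
    ultimately have "t i = mobius_point q r \<theta> i" and k: "(\<sigma> i * \<epsilon> * \<rho>) ^ 4 = 1"
      using representative_unique t[OF i] mobius_point_polar(1)[OF q, where r = r and \<theta> = \<theta> and i = i] by blast+
    moreover have "p i = P * \<rho> ^ 4"
    proof -
      have "\<epsilon> ^ 4 = (\<epsilon>\<^sup>2)\<^sup>2" by algebra
      then have "\<sigma> i ^ 4 * \<rho> ^ 4 = 1" using k \<epsilon>(1) by (simp add: power_mult_distrib)
      then have "p i = p i * (\<sigma> i ^ 4 * \<rho> ^ 4)" by simp
      also have "\<dots> = P * \<rho> ^ 4" unfolding p[OF i, symmetric] by simp
      finally show ?thesis .
    qed
    ultimately show ?thesis unfolding \<rho>(3) by simp
  qed
  \<comment> \<open>Because the weights add up to 1, \<open>P\<close> must be the normalizing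
    constant.\<close>
  have "P * (\<Sum>j\<in>{1,2,3}. mobius_raw_weight q r \<theta> j) = (\<Sum>j\<in>{1,2,3}. p j)"
    unfolding sum_distrib_left by (rule sum.cong) (use eq in auto)
  then have PS: "P * (\<Sum>j\<in>{1,2,3}. mobius_raw_weight q r \<theta> j) = 1" using sum by simp
  then have "P = 1 / (\<Sum>j\<in>{1,2,3}. mobius_raw_weight q r \<theta> j)"
    by (metis mult_zero_right nonzero_eq_divide_eq zero_neq_one)
  then have "mobius_weight q r \<theta> i = P * mobius_raw_weight q r \<theta> i" for i
    unfolding mobius_weight_def Let_def by simp
  then have "(\<lambda>i. (t i, p i)) ` {1,2,3} = mobius_design q r \<theta>"
    unfolding mobius_design_def by (intro image_cong refl) (use eq in simp)
  then show ?thesis by blast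
qed

text \<open>The transformation is triangular with diagonal entries \<open>l * q ^ k\<close>.\<close>

lemma affine_moments_inject:
  assumes q: "q \<noteq> 0" and l: "l \<noteq> 0"
    and eq: "\<forall>k\<le>4. affine_moments l q r m k = affine_moments l q r m' k"
  shows "\<forall>k\<le>4. m k = m' k"
proof -
  have "m k = m' k" if "k \<le> 4" for k
    using that
  proof (induction k rule: less_induct)
    case (less k)
    have "affine_moments l q r m k = affine_moments l q r m' k" using eq less.prems by blast
    then have "(\<Sum>j\<le>k. of_nat (k choose j) * q ^ j * r ^ (k - j) * m j)
        = (\<Sum>j\<le>k. of_nat (k choose j) * q ^ j * r ^ (k - j) * m' j)"
      using l by (simp add: affine_moments_def)
    moreover have "(\<Sum>j<k. of_nat (k choose j) * q ^ j * r ^ (k - j) * m j)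
        = (\<Sum>j<k. of_nat (k choose j) * q ^ j * r ^ (k - j) * m' j)"
      by (rule sum.cong) (use less in auto)
    ultimately have "q ^ k * m k = q ^ k * m' k"
      by (simp add: lessThan_Suc_atMost[symmetric])
    then show ?case using q by simp
  qed
  then show ?thesis by blast
qed

text \<open>The points are pulled back through the affine map, \<open>orthogonal_points\<close>
  shows that the preimages are equally spaced, and a relabelling settles the orientation.\<close>

lemma three_point_isotropic_mobius:
  assumes \<xi>: "is_design \<xi>" and card: "card \<xi> = 3" and iso: "isotropic_moments (design_moments \<xi>)"
  shows "\<exists>q r \<theta>. q \<noteq> 0 \<and> \<xi> = mobius_design q r \<theta>"
proof -
  obtain l q r where l: "l > 0" and q: "q > 0"
    and eq: "\<forall>k\<le>4. design_moments \<xi> k = affine_moments l q r (canonical_moments 0 0) k"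
    using iso unfolding isotropic_moments_def by blast
  obtain x1 x2 x3 where x: "\<xi> = {x1, x2, x3}" "x1 \<noteq> x2" "x1 \<noteq> x3" "x2 \<noteq> x3"
    using card by (auto simp: card_3_iff)
  define x where "x i = (if i = 1 then x1 else if i = 2 then x2 else x3)" for i :: nat
  define t p where "t i = fst (x i)" and "p i = snd (x i)" for i
  have \<xi>_eq: "\<xi> = (\<lambda>i. (t i, p i)) ` {1,2,3}" by (auto simp: t_def p_def x_def x(1))
  have inj: "inj_on (\<lambda>i. (t i, p i)) {1,2,3}" using x by (auto simp: inj_on_def t_def p_def x_def)
  have sum_\<xi>: "(\<Sum>x\<in>\<xi>. F x) = (\<Sum>i\<in>{1,2,3}. F (t i, p i))" for F :: "real \<times> real \<Rightarrow> real"
    unfolding \<xi>_eq by (subst sum.reindex[OF inj]) simp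
  have t: "- 1/2 < t i \<and> t i \<le> 1/2" and p: "p i > 0" if "i \<in> {1,2,3}" for i
    using \<xi> that unfolding is_design_def by (auto simp: \<xi>_eq)
  have sum: "(\<Sum>i\<in>{1,2,3}. p i) = 1"
    using \<xi> unfolding is_design_def sum_\<xi> by simp
  \<comment> \<open>\<open>(C i, X i)\<close> is the preimage of the unit vector of the point under
    \<open>(c, s) \<mapsto> (c, q * s + r * c)\<close>.\<close>
  define C X where "C i = cos (pi * t i)" and "X i = (sin (pi * t i) - r * cos (pi * t i)) / q" for i
  define \<sigma> where "\<sigma> i = sqrt ((C i)\<^sup>2 + (X i)\<^sup>2)" for i
  have sin_t: "sin (pi * t i) = q * X i + r * C i" for i using q by (simp add: C_def X_def)
  have "(C i)\<^sup>2 + (X i)\<^sup>2 > 0" for i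
  proof -
    have "C i \<noteq> 0 \<or> X i \<noteq> 0"
    proof (rule ccontr)
      assume "\<not> (C i \<noteq> 0 \<or> X i \<noteq> 0)"
      then have "cos (pi * t i) = 0" "sin (pi * t i) = 0" using sin_t[of i] by (simp_all add: C_def)
      then show False using sin_cos_squared_add[of "pi * t i"] by simp
    qed
    then show ?thesis by (simp add: sum_power2_gt_zero_iff)
  qed
  then have \<sigma>: "\<sigma> i > 0" "(\<sigma> i)\<^sup>2 = (C i)\<^sup>2 + (X i)\<^sup>2" for i by (auto simp: \<sigma>_def less_imp_le)
  have "\<exists>u. \<forall>i. C i = \<sigma> i * cos (u i) \<and> X i = \<sigma> i * sin (u i)"
  proof (rule choice, rule allI)
    fix i
    have "(C i / \<sigma> i)\<^sup>2 + (X i / \<sigma> i)\<^sup>2 = 1"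
      using \<sigma>(1)[of i] unfolding power_divide add_divide_distrib[symmetric] \<sigma>(2)[symmetric] by simp
    then obtain v where "C i / \<sigma> i = cos v" "X i / \<sigma> i = sin v" using sincos_total_2pi by blast
    then show "\<exists>v. C i = \<sigma> i * cos v \<and> X i = \<sigma> i * sin v" using \<sigma>(1)[of i] by (intro exI[of _ v]) (auto simp: field_simps)
  qed
  then obtain u where u: "\<And>i. C i = \<sigma> i * cos (u i)" "\<And>i. X i = \<sigma> i * sin (u i)" by blast
  \<comment> \<open>Normalizing the preimages to unit vectors moves the fourth power of their length
    into the weights.\<close>
  define P where "P i = p i * \<sigma> i ^ 4" for i
  have P: "P i > 0" if "i \<in> {1,2,3}" for i using p[OF that] \<sigma>(1)[of i] by (simp add: P_def)
  define b where "b k = (\<Sum>i\<in>{1,2,3}. p i * (C i ^ (4 - k) * X i ^ k))" for k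
  have "design_moments \<xi> k = affine_moments 1 q r b k" if "k \<le> 4" for k
  proof -
    have "design_moments \<xi> k = (\<Sum>i\<in>{1,2,3}. p i * (C i ^ (4 - k) * (q * X i + r * C i) ^ k))"
      unfolding design_moments_def sum_\<xi> sin_t prod.case C_def[symmetric] by (simp only: mult.assoc)
    then show ?thesis unfolding b_def
      using sum_affine_moments[where I = "{1,2,3}" and a = p and q = q and r = r and c = C and s = X] that by simp
  qed
  moreover have "affine_moments l q r (canonical_moments 0 0) k = affine_moments 1 q r (\<lambda>k. l * canonical_moments 0 0 k) k" for k
    unfolding affine_moments_def by (simp add: sum_distrib_left mult_ac)
  ultimately have "\<forall>k\<le>4. affine_moments 1 q r b k = affine_moments 1 q r (\<lambda>k. l * canonical_moments 0 0 k) k"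
    using eq by simp
  then have b: "\<forall>k\<le>4. b k = l * canonical_moments 0 0 k"
    by (rule affine_moments_inject[rotated 2]) (use q in auto)
  have "\<forall>k\<le>4. (\<Sum>i\<in>{1,2,3}. P i * (cos (u i) ^ (4 - k) * sin (u i) ^ k)) = l * canonical_moments 0 0 k"
  proof (intro allI impI)
    fix k :: nat assume k: "k \<le> 4"
    have "P i * (cos (u i) ^ (4 - k) * sin (u i) ^ k) = p i * (C i ^ (4 - k) * X i ^ k)" for i
    proof -
      have "\<sigma> i ^ 4 = \<sigma> i ^ (4 - k) * \<sigma> i ^ k" using k by (simp add: power_add[symmetric])
      then show ?thesis unfolding u P_def by (simp add: power_mult_distrib)
    qed
    then show "(\<Sum>i\<in>{1,2,3}. P i * (cos (u i) ^ (4 - k) * sin (u i) ^ k)) = l * canonical_moments 0 0 k"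
      using b k unfolding b_def by simp
  qed
  note mom = this
  have orth1: "P i = 2 * l / 3" if "i \<in> {1,2,3}" for i
    by (rule orthogonal_points(1)[OF l _ mom that]) (rule P)
  have orth2: "cos (2 * (u i - u j)) = - 1/2" if "i \<in> {1,2,3}" "j \<in> {1,2,3}" "i \<noteq> j" for i j
    by (rule orthogonal_points(2)[OF l _ mom that]) (rule P)
  have s2: "(sin (2 * (u i - u j)))\<^sup>2 = (sqrt 3 / 2)\<^sup>2" if "i \<in> {1,2,3}" "j \<in> {1,2,3}" "i \<noteq> j" for i j
    using sin_cos_squared_add[of "2 * (u i - u j)"] unfolding orth2[OF that] by (simp add: power_divide)
  have s12: "sin (2 * (u 1 - u 2)) = sqrt 3 / 2 \<or> sin (2 * (u 1 - u 2)) = - (sqrt 3 / 2)"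
    using s2[of 1 2] unfolding power2_eq_iff by simp
  have s32: "sin (2 * (u 3 - u 2)) = sqrt 3 / 2 \<or> sin (2 * (u 3 - u 2)) = - (sqrt 3 / 2)"
    using s2[of 3 2] unfolding power2_eq_iff by simp
  \<comment> \<open>Equal sines would make \<open>2 * u 1\<close> and \<open>2 * u 3\<close> agree
    modulo a full turn, against \<open>orth2\<close>.\<close>
  have ne: "sin (2 * (u 1 - u 2)) \<noteq> sin (2 * (u 3 - u 2))"
  proof
    assume same: "sin (2 * (u 1 - u 2)) = sin (2 * (u 3 - u 2))"
    have "2 * (u 1 - u 3) = 2 * (u 1 - u 2) - 2 * (u 3 - u 2)" by simp
    then have "cos (2 * (u 1 - u 3)) = cos (2 * (u 1 - u 2)) * cos (2 * (u 3 - u 2)) + sin (2 * (u 1 - u 2)) * sin (2 * (u 3 - u 2))"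
      by (simp only: cos_diff)
    also have "\<dots> = 1" using orth2[of 1 2] orth2[of 3 2] s2[of 3 2] same
      by (simp add: power2_eq_square)
    finally show False using orth2[of 1 3] by simp
  qed
  \<comment> \<open>If the orientation is the wrong one, \<open>4 - i\<close> swaps the labels 1 and
    3 and keeps 2.\<close>
  define \<pi> where "\<pi> i = (if sin (2 * (u 1 - u 2)) = - (sqrt 3 / 2) then i else 4 - i)" for i :: nat
  have \<pi>: "\<pi> i \<in> {1,2,3}" if "i \<in> {1,2,3}" for i using that by (auto simp: \<pi>_def)
  have \<pi>_img: "\<pi> ` {1,2,3} = {1,2,3}" by (auto simp: \<pi>_def)
  have \<pi>2: "\<pi> 2 = 2" by (simp add: \<pi>_def)
  have trig: "sin (2 * (u (\<pi> 1) - u (\<pi> 2))) = - (sqrt 3 / 2)" "sin (2 * (u (\<pi> 3) - u (\<pi> 2))) = sqrt 3 / 2"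
    "cos (2 * (u (\<pi> 1) - u (\<pi> 2))) = - 1/2" "cos (2 * (u (\<pi> 3) - u (\<pi> 2))) = - 1/2"
    using s12 s32 ne orth2[of 1 2] orth2[of 3 2] by (auto simp: \<pi>_def)
  have "\<exists>\<theta>. (\<lambda>i. (t (\<pi> i), p (\<pi> i))) ` {1,2,3} = mobius_design q r \<theta>"
  proof (rule design_eq_mobius_design[where u = "\<lambda>i. u (\<pi> i)" and \<sigma> = "\<lambda>i. \<sigma> (\<pi> i)" and P = "2 * l / 3"])
    show "(\<Sum>i\<in>{1,2,3}. p (\<pi> i)) = 1"
      using sum by (simp add: \<pi>_def) 
    show "sin (pi * t (\<pi> i)) = \<sigma> (\<pi> i) * (q * sin (u (\<pi> i)) + r * cos (u (\<pi> i)))" for i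
      unfolding sin_t u by (simp add: algebra_simps)
    show "cos (pi * t (\<pi> i)) = \<sigma> (\<pi> i) * cos (u (\<pi> i))" for i
      unfolding u(1)[symmetric] C_def ..
    show "p (\<pi> i) * \<sigma> (\<pi> i) ^ 4 = 2 * l / 3" if "i \<in> {1,2,3}" for i
      using orth1[OF \<pi>[OF that]] by (simp add: P_def)
    show "- 1/2 < t (\<pi> i) \<and> t (\<pi> i) \<le> 1/2" if "i \<in> {1,2,3}" for i using t[OF \<pi>[OF that]] .
    show "\<sigma> (\<pi> i) \<noteq> 0" for i using \<sigma>(1)[of "\<pi> i"] by simp
  qed (use q trig in simp_all)
  moreover have "(\<lambda>i. (t (\<pi> i), p (\<pi> i))) ` {1,2,3} = (\<lambda>i. (t i, p i)) ` \<pi> ` {1,2,3}"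
    unfolding image_image ..
  ultimately have "\<exists>\<theta>. \<xi> = mobius_design q r \<theta>" unfolding \<pi>_img \<xi>_eq by simp
  then show ?thesis using q by (metis less_irrefl)
qed

theorem theorem4p10:
  shows "{\<xi>. is_design \<xi> \<and> card \<xi> = 3 \<and> tube_volume_optimal \<xi>}
           = {mobius_design q r \<theta> | q r \<theta>. q \<noteq> 0}
       \<and> (\<forall>\<theta>. D_optimal (uniform_design \<theta>) \<and> tube_volume_optimal (uniform_design \<theta>))"
proof (intro conjI allI)
  show "{\<xi>. is_design \<xi> \<and> card \<xi> = 3 \<and> tube_volume_optimal \<xi>} = {mobius_design q r \<theta> | q r \<theta>. q \<noteq> 0}"
  proof (intro set_eqI iffI)
    fix \<xi> assume "\<xi> \<in> {\<xi>. is_design \<xi> \<and> card \<xi> = 3 \<and> tube_volume_optimal \<xi>}"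
    then show "\<xi> \<in> {mobius_design q r \<theta> | q r \<theta>. q \<noteq> 0}"
      using three_point_isotropic_mobius tube_volume_optimal_iff by blast
  next
    fix \<xi> assume "\<xi> \<in> {mobius_design q r \<theta> | q r \<theta>. q \<noteq> 0}"
    then show "\<xi> \<in> {\<xi>. is_design \<xi> \<and> card \<xi> = 3 \<and> tube_volume_optimal \<xi>}"
      using mobius_design_isotropic tube_volume_optimal_iff by blast
  qed
  show "D_optimal (uniform_design \<theta>)" for \<theta> by (rule D_optimal_uniform_design)
  show "tube_volume_optimal (uniform_design \<theta>)" for \<theta>
    using tube_volume_optimal_iff uniform_design_moments(1) isotropic_uniform_design by blast
qed

end
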